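(* Let $(X,T)$ and $(Y,S)$ be minimal systems. Let $\alpha: X\to Eq(X,Y)$ and $\beta: Y\to Eq(X,Y)$ be the factor maps onto the maximal common equicontinuous factor, and let $\gamma: X\times Y\to Eq(X,Y)$, $\gamma(x,y)=\alpha(x)-\beta(y)$. Then the following assertions are equivalent: (1) There is some point $z\in Eq(X,Y)$ such that $\gamma^{-1}(z)$ has a unique minimal subset (with respect to $T\times S$). (2) There is a dense $G_\delta$ subset $\Omega\subset Eq(X,Y)$ such that for each $z\in\Omega$, $\gamma^{-1}(z)$ has a unique minimal subset (with respect to $T\times S$). (3) $(X,T)$ and $(Y,S)$ are quasi-disjoint.
   Context: A system $(X,T)$ is a compact metric space $X$ with a homeomorphism $T:X\to X$. It is minimal if every orbit $\{T^nx:n\in\mathbb Z\}$ is dense. A minimal subset is a nonempty closed invariant set in which every orbit is dense. A factor map (homomorphism) $\pi:(X,T)\to(Y,S)$ is a continuous surjection with $\pi\circ T=S\circ\pi$. A system is equicontinuous if for every $\epsilon>0$ there is $\delta>0$ such that $\rho(x,y)<\delta$ implies $\rho(T^nx,T^ny)<\epsilon$ for all $n\in\mathbb Z$. For a minimal system $(X,T)$, $\pi_X:X\to X_{eq}$ denotes its maximal equicontinuous factor (every factor map from $X$ to an equicontinuous system factors through $\pi_X$). A joining of $(X,T)$ and $(Y,S)$ is a closed $T\times S$-invariant subset of $X\times Y$ with full projections onto $X$ and onto $Y$. Minimal systems $(X,T)$, $(Y,S)$ are quasi-disjoint if $X\times Y$ is the only joining $J$ of $X$ and $Y$ satisfying $(\pi_X\times\pi_Y)(J)=X_{eq}\times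 Y_{eq}$. A maximal common equicontinuous factor of minimal systems $(X,T)$ and $(Y,S)$ is an equicontinuous system $(Z,R)$ with factor maps $\alpha:X\to Z$, $\beta:Y\to Z$ such that for every equicontinuous system $(W,Q)$ and factor maps $\phi:X\to W$, $\psi:Y\to W$ there are factor maps $\eta_1,\eta_2:Z\to W$ with $\phi=\eta_1\alpha$ and $\psi=\eta_2\beta$. It exists and is unique up to isomorphism, and is denoted $Eq(X,Y)$. Being minimal and equicontinuous, it is identified with a compact abelian metrizable group on which $R$ is translation by a fixed element; subtraction in $\gamma$ refers to this group. The map $\gamma$ is $T\times S$-invariant, so each $\gamma^{-1}(z)$ is a closed $T\times S$-invariant set. *)

theory Defs
  imports "HOL-Analysis.Analysis" "HOL-Algebra.Group"
begin

section \<open>Systems\<close>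

text \<open>Spaces are abstract metric spaces of type \<^typ>\<open>'a metric\<close>; a map is relevant only on the
  carrier \<^term>\<open>mspace X\<close>.\<close>

definition dyn_system :: "'a metric \<Rightarrow> ('a \<Rightarrow> 'a) \<Rightarrow> bool" where
  "dyn_system X T \<longleftrightarrow>
     compact_space (mtopology_of X) \<and> homeomorphic_map (mtopology_of X) (mtopology_of X) T"

text \<open>The integer iterate; for negative exponents the inverse is taken on the carrier.\<close>

definition ziter :: "'a metric \<Rightarrow> ('a \<Rightarrow> 'a) \<Rightarrow> int \<Rightarrow> 'a \<Rightarrow> 'a" where
  "ziter X T n = (if 0 \<le> n then T ^^ nat n else inv_into (mspace X) T ^^ nat (- n))"

definition zorbit :: "'a metric \<Rightarrow> ('a \<Rightarrow> 'a) \<Rightarrow> 'a \<Rightarrow> 'a set" where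
  "zorbit X T x = {ziter X T n x |n. True}"

definition minimal_system :: "'a metric \<Rightarrow> ('a \<Rightarrow> 'a) \<Rightarrow> bool" where
  "minimal_system X T \<longleftrightarrow>
     dyn_system X T \<and> (\<forall>x\<in>mspace X. mtopology_of X closure_of zorbit X T x = mspace X)"

text \<open>As the acting group is the group of integers, invariance of a set means \<open>T ` A = A\<close>.\<close>

definition closed_invariant :: "'a metric \<Rightarrow> ('a \<Rightarrow> 'a) \<Rightarrow> 'a set \<Rightarrow> bool" where
  "closed_invariant X T A \<longleftrightarrow> closedin (mtopology_of X) A \<and> T ` A = A"

definition minimal_subset :: "'a metric \<Rightarrow> ('a \<Rightarrow> 'a) \<Rightarrow> 'a set \<Rightarrow> bool" where
  "minimal_subset X T M \<longleftrightarrow>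
     M \<noteq> {} \<and> closed_invariant X T M \<and> (\<forall>x\<in>M. mtopology_of X closure_of zorbit X T x = M)"

definition factor_map ::
    "'a metric \<Rightarrow> ('a \<Rightarrow> 'a) \<Rightarrow> 'b metric \<Rightarrow> ('b \<Rightarrow> 'b) \<Rightarrow> ('a \<Rightarrow> 'b) \<Rightarrow> bool" where
  "factor_map X T Y S \<pi> \<longleftrightarrow>
     continuous_map (mtopology_of X) (mtopology_of Y) \<pi> \<and> \<pi> ` mspace X = mspace Y \<and>
     (\<forall>x\<in>mspace X. \<pi> (T x) = S (\<pi> x))"

definition equicontinuous_system :: "'a metric \<Rightarrow> ('a \<Rightarrow> 'a) \<Rightarrow> bool" where
  "equicontinuous_system X T \<longleftrightarrow>
     dyn_system X T \<and>
     (\<forall>\<epsilon>>0. \<exists>\<delta>>0. \<forall>x\<in>mspace X. \<forall>y\<in>mspace X.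
        mdist X x y < \<delta> \<longrightarrow> (\<forall>n. mdist X (ziter X T n x) (ziter X T n y) < \<epsilon>))"

section \<open>Maximal equicontinuous factors\<close>

text \<open>A definition cannot quantify over types, so the test systems \<open>W\<close> below have their points in
  \<^typ>\<open>real\<close> (with an arbitrary metric). This loses nothing: compact metric spaces have at most
  continuum many points, and the lemmas \<open>max_equicontinuous_factorD\<close> and \<open>max_common_factorD\<close> at
  the end derive the universal properties for test systems over an arbitrary type.\<close>

definition max_equicontinuous_factor ::
    "'a metric \<Rightarrow> ('a \<Rightarrow> 'a) \<Rightarrow> 'b metric \<Rightarrow> ('b \<Rightarrow> 'b) \<Rightarrow> ('a \<Rightarrow> 'b) \<Rightarrow> bool" where
  "max_equicontinuous_factor X T Z R \<pi> \<longleftrightarrow>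
     equicontinuous_system Z R \<and> factor_map X T Z R \<pi> \<and>
     (\<forall>(W :: real metric) Q \<phi>.
        equicontinuous_system W Q \<longrightarrow> factor_map X T W Q \<phi> \<longrightarrow>
        (\<exists>\<eta>. factor_map Z R W Q \<eta> \<and> (\<forall>x\<in>mspace X. \<phi> x = \<eta> (\<pi> x))))"

definition max_common_factor ::
    "'a metric \<Rightarrow> ('a \<Rightarrow> 'a) \<Rightarrow> 'b metric \<Rightarrow> ('b \<Rightarrow> 'b) \<Rightarrow>
     'c metric \<Rightarrow> ('c \<Rightarrow> 'c) \<Rightarrow> ('a \<Rightarrow> 'c) \<Rightarrow> ('b \<Rightarrow> 'c) \<Rightarrow> bool" where
  "max_common_factor X T Y S Z R \<alpha> \<beta> \<longleftrightarrow>
     equicontinuous_system Z R \<and> factor_map X T Z R \<alpha> \<and> factor_map Y S Z R \<beta> \<and>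
     (\<forall>(W :: real metric) Q \<phi> \<psi>.
        equicontinuous_system W Q \<longrightarrow> factor_map X T W Q \<phi> \<longrightarrow> factor_map Y S W Q \<psi> \<longrightarrow>
        (\<exists>\<eta>1 \<eta>2. factor_map Z R W Q \<eta>1 \<and> factor_map Z R W Q \<eta>2 \<and>
           (\<forall>x\<in>mspace X. \<phi> x = \<eta>1 (\<alpha> x)) \<and> (\<forall>y\<in>mspace Y. \<psi> y = \<eta>2 (\<beta> y))))"

text \<open>\<open>G\<close> is a group structure on the points of \<open>Z\<close> making it a compact abelian (metrizable)
  topological group on which \<open>R\<close> is translation by a fixed element.\<close>

definition group_rotation :: "'a metric \<Rightarrow> ('a \<Rightarrow> 'a) \<Rightarrow> 'a monoid \<Rightarrow> bool" where
  "group_rotation Z R G \<longleftrightarrow>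
     comm_group G \<and> carrier G = mspace Z \<and>
     compact_space (mtopology_of Z) \<and>
     continuous_map (prod_topology (mtopology_of Z) (mtopology_of Z)) (mtopology_of Z)
       (\<lambda>(x, y). x \<otimes>\<^bsub>G\<^esub> y) \<and>
     continuous_map (mtopology_of Z) (mtopology_of Z) (\<lambda>x. inv\<^bsub>G\<^esub> x) \<and>
     (\<exists>g\<in>carrier G. \<forall>z\<in>carrier G. R z = g \<otimes>\<^bsub>G\<^esub> z)"

section \<open>Joinings, quasi-disjointness, and the map \<open>\<gamma>\<close>\<close>

definition joining ::
    "'a metric \<Rightarrow> ('a \<Rightarrow> 'a) \<Rightarrow> 'b metric \<Rightarrow> ('b \<Rightarrow> 'b) \<Rightarrow> ('a \<times> 'b) set \<Rightarrow> bool" where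
  "joining X T Y S J \<longleftrightarrow>
     closed_invariant (prod_metric X Y) (map_prod T S) J \<and>
     fst ` J = mspace X \<and> snd ` J = mspace Y"

text \<open>Here \<open>\<pi>X\<close> and \<open>\<pi>Y\<close> are meant to be the maximal equicontinuous factor maps, onto \<open>Xeq\<close>
  and \<open>Yeq\<close>.\<close>

definition quasi_disjoint ::
    "'a metric \<Rightarrow> ('a \<Rightarrow> 'a) \<Rightarrow> 'c metric \<Rightarrow> ('a \<Rightarrow> 'c) \<Rightarrow>
     'b metric \<Rightarrow> ('b \<Rightarrow> 'b) \<Rightarrow> 'd metric \<Rightarrow> ('b \<Rightarrow> 'd) \<Rightarrow> bool" where
  "quasi_disjoint X T Xeq \<pi>X Y S Yeq \<pi>Y \<longleftrightarrow>
     {J. joining X T Y S J \<and> map_prod \<pi>X \<pi>Y ` J = mspace Xeq \<times> mspace Yeq}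
       = {mspace X \<times> mspace Y}"

definition diff_map :: "'c monoid \<Rightarrow> ('a \<Rightarrow> 'c) \<Rightarrow> ('b \<Rightarrow> 'c) \<Rightarrow> 'a \<times> 'b \<Rightarrow> 'c" where
  "diff_map G \<alpha> \<beta> = (\<lambda>(x, y). \<alpha> x \<otimes>\<^bsub>G\<^esub> inv\<^bsub>G\<^esub> (\<beta> y))"

definition fibre :: "'a metric \<Rightarrow> ('a \<Rightarrow> 'b) \<Rightarrow> 'b \<Rightarrow> 'a set" where
  "fibre X f z = {x \<in> mspace X. f x = z}"

definition has_unique_minimal_subset :: "'a metric \<Rightarrow> ('a \<Rightarrow> 'a) \<Rightarrow> 'a set \<Rightarrow> bool" where
  "has_unique_minimal_subset X T A \<longleftrightarrow> (\<exists>!M. minimal_subset X T M \<and> M \<subseteq> A)"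

section \<open>Test systems over arbitrary types\<close>

lemma compact_metric_inject_real:
  fixes W :: "'w metric"
  assumes "compact_space (mtopology_of W)"
  shows "\<exists>f :: 'w \<Rightarrow> real. inj_on f (mspace W)"
proof -
  interpret Metric_space "mspace W" "mdist W" by simp
  have tb: "mtotally_bounded (mspace W)"
    using assms by (simp add: mtopology_of_def compact_space_def compactin_imp_mtotally_bounded)
  have "\<forall>k. \<exists>K. finite K \<and> K \<subseteq> mspace W \<and> mspace W \<subseteq> (\<Union>x\<in>K. mball x (1 / real (Suc k)))"
    using tb unfolding mtotally_bounded_def by simp
  then obtain K where K: "\<And>k. finite (K k)" "\<And>k. K k \<subseteq> mspace W"
    "\<And>k. mspace W \<subseteq> (\<Union>x\<in>K k. mball x (1 / real (Suc k)))" by metis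
  define D where "D = (\<Union>k. K k)"
  have cD: "countable D" unfolding D_def using K(1) by (simp add: countable_finite)
  define F where "F x = {prod_encode (to_nat_on D y, k) |y k. y \<in> D \<and> mdist W x y < 1 / real (Suc k)}" for x
  have inF: "prod_encode (to_nat_on D y, k) \<in> F x \<longleftrightarrow> mdist W x y < 1 / real (Suc k)"
    if "y \<in> D" for x y k
    using that cD by (auto simp: F_def)
  have "inj_on F (mspace W)"
  proof (rule inj_onI, rule ccontr)
    fix x y assume xy: "x \<in> mspace W" "y \<in> mspace W" "F x = F y" "x \<noteq> y"
    have pos: "mdist W x y > 0" using xy by (simp add: mdist_pos_less)
    then obtain k where k: "1 / real (Suc k) < mdist W x y / 2"
      by (metis half_gt_zero nat_approx_posE)
    obtain c where c: "c \<in> K k" "x \<in> mball c (1 / real (Suc k))" using K(3)[of k] xy(1) by blast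
    then have cD': "c \<in> D" "c \<in> mspace W" "mdist W x c < 1 / real (Suc k)"
      using K(2) by (auto simp: D_def commute)
    then have "mdist W y c < 1 / real (Suc k)" using inF xy(3) by blast
    moreover have "mdist W x y \<le> mdist W x c + mdist W y c"
      using triangle[of x c y] xy cD' by (simp add: commute)
    ultimately show False using cD' k by linarith
  qed
  moreover obtain g :: "nat set \<Rightarrow> real" where "inj g"
    using nat_sets_eqpoll_reals unfolding eqpoll_def bij_betw_def by blast
  ultimately have "inj_on (g \<circ> F) (mspace W)" by (metis comp_inj_on inj_on_subset subset_UNIV)
  then show ?thesis by blast
qed

lemma dyn_system_bij: "dyn_system X T \<Longrightarrow> bij_betw T (mspace X) (mspace X)"
  unfolding dyn_system_def
  by (metis bij_betw_def homeomorphic_imp_injective_map homeomorphic_imp_surjective_map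
      topspace_mtopology_of)

lemma factor_map_compose:
  assumes "factor_map X T Y S f" "factor_map Y S Z R g"
  shows "factor_map X T Z R (g \<circ> f)"
  using assms unfolding factor_map_def
  by (auto simp: continuous_map_compose simp flip: image_image)

lemma equicontinuous_system_real_copy:
  fixes W :: "'w metric"
  assumes W: "equicontinuous_system W T"
  shows "\<exists>(N :: real metric) Q f g. equicontinuous_system N Q \<and> factor_map W T N Q f \<and>
           factor_map N Q W T g \<and> (\<forall>x\<in>mspace W. g (f x) = x)"
proof -
  have dyn: "dyn_system W T" using W by (simp add: equicontinuous_system_def)
  have comp: "compact_space (mtopology_of W)"
    and hom: "homeomorphic_map (mtopology_of W) (mtopology_of W) T"
    using dyn by (auto simp: dyn_system_def)
  have bT: "bij_betw T (mspace W) (mspace W)" using dyn by (rule dyn_system_bij)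
  obtain f :: "'w \<Rightarrow> real" where f: "inj_on f (mspace W)"
    using compact_metric_inject_real[OF comp] by blast
  define g where "g = inv_into (mspace W) f"
  have gf: "g (f x) = x" if "x \<in> mspace W" for x using f that by (simp add: g_def)
  interpret N: Metric_space "f ` mspace W" "\<lambda>a b. mdist W (g a) (g b)"
  proof
    show "0 \<le> mdist W (g a) (g b)" for a b by simp
    show "mdist W (g a) (g b) = mdist W (g b) (g a)" for a b by (simp add: mdist_commute)
    show "mdist W (g a) (g b) = 0 \<longleftrightarrow> a = b" if "a \<in> f ` mspace W" "b \<in> f ` mspace W" for a b
      using that by (auto simp: gf)
    show "mdist W (g a) (g c) \<le> mdist W (g a) (g b) + mdist W (g b) (g c)"
      if "a \<in> f ` mspace W" "b \<in> f ` mspace W" "c \<in> f ` mspace W" for a b c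
      using that by (auto simp: gf mdist_triangle)
  qed
  define N where "N = metric (f ` mspace W, \<lambda>a b. mdist W (g a) (g b))"
  have spN: "mspace N = f ` mspace W" and dN: "mdist N = (\<lambda>a b. mdist W (g a) (g b))"
    by (simp_all add: N_def)
  define Q where "Q = f \<circ> T \<circ> g"
  have Lf: "continuous_map (mtopology_of W) (mtopology_of N) f"
    by (rule Lipschitz_continuous_imp_continuous_map)
       (auto simp: Lipschitz_continuous_map_def spN dN gf intro!: exI[of _ 1])
  have Lg: "continuous_map (mtopology_of N) (mtopology_of W) g"
    by (rule Lipschitz_continuous_imp_continuous_map)
       (auto simp: Lipschitz_continuous_map_def spN dN gf intro!: exI[of _ 1])
  have hf: "homeomorphic_map (mtopology_of W) (mtopology_of N) f"
    and hg: "homeomorphic_map (mtopology_of N) (mtopology_of W) g"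
    using Lf Lg by (auto simp: homeomorphic_map_maps homeomorphic_maps_def spN gf)
  have dynN: "dyn_system N Q"
    unfolding dyn_system_def Q_def
    using hf hg hom comp
    by (metis homeomorphic_map_compose homeomorphic_map_imp_homeomorphic_space
        homeomorphic_compact_space comp_assoc)
  have bQ: "bij_betw Q (mspace N) (mspace N)" using dynN by (rule dyn_system_bij)
  have Tin: "T x \<in> mspace W" "inv_into (mspace W) T x \<in> mspace W" if "x \<in> mspace W" for x
    using bT that by (auto simp: bij_betw_def inv_into_into)
  have Qf: "Q (f x) = f (T x)" if "x \<in> mspace W" for x using that by (simp add: Q_def gf)
  have Qif: "inv_into (mspace N) Q (f x) = f (inv_into (mspace W) T x)" if "x \<in> mspace W" for x
  proof -
    have "Q (f (inv_into (mspace W) T x)) = f x"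
      using Qf Tin(2)[OF that] bT that by (simp add: bij_betw_def f_inv_into_f)
    then show ?thesis using bQ Tin(2)[OF that]
      by (metis bij_betw_def image_eqI inv_into_f_f spN)
  qed
  have pT: "(T ^^ k) x \<in> mspace W \<and> (Q ^^ k) (f x) = f ((T ^^ k) x)" if "x \<in> mspace W" for k x
    by (induction k) (use that Tin Qf in auto)
  have pI: "(inv_into (mspace W) T ^^ k) x \<in> mspace W \<and>
      (inv_into (mspace N) Q ^^ k) (f x) = f ((inv_into (mspace W) T ^^ k) x)"
    if "x \<in> mspace W" for k x
    by (induction k) (use that Tin Qif in auto)
  have zi: "ziter W T n x \<in> mspace W" "ziter N Q n (f x) = f (ziter W T n x)"
    if "x \<in> mspace W" for n x
    using pT[OF that] pI[OF that] by (auto simp: ziter_def)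
  have "equicontinuous_system N Q"
    using W dynN by (simp add: equicontinuous_system_def spN dN gf zi)
  moreover have "factor_map W T N Q f"
    using Lf by (simp add: factor_map_def spN Qf)
  moreover have "factor_map N Q W T g"
    using Lg by (auto simp: factor_map_def spN Qf gf Tin image_image)
  ultimately show ?thesis using gf by blast
qed

lemma max_equicontinuous_factorD:
  fixes W :: "'w metric"
  assumes m: "max_equicontinuous_factor X T Z R \<pi>"
    and W: "equicontinuous_system W Q" "factor_map X T W Q \<phi>"
  shows "\<exists>\<eta>. factor_map Z R W Q \<eta> \<and> (\<forall>x\<in>mspace X. \<phi> x = \<eta> (\<pi> x))"
proof -
  obtain N :: "real metric" and Q' f g where N: "equicontinuous_system N Q'"
    "factor_map W Q N Q' f" "factor_map N Q' W Q g" "\<forall>x\<in>mspace W. g (f x) = x"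
    using equicontinuous_system_real_copy[OF W(1)] by blast
  have "factor_map X T N Q' (f \<circ> \<phi>)" using W(2) N(2) by (rule factor_map_compose)
  then obtain \<eta> where \<eta>: "factor_map Z R N Q' \<eta>" "\<forall>x\<in>mspace X. (f \<circ> \<phi>) x = \<eta> (\<pi> x)"
    using m N(1) unfolding max_equicontinuous_factor_def by blast
  have "\<forall>x\<in>mspace X. \<phi> x \<in> mspace W" using W(2) by (auto simp: factor_map_def)
  then have "\<forall>x\<in>mspace X. \<phi> x = (g \<circ> \<eta>) (\<pi> x)" using \<eta>(2) N(4) by (metis comp_apply)
  then show ?thesis using factor_map_compose[OF \<eta>(1) N(3)] by blast
qed

lemma max_common_factorD:
  fixes W :: "'w metric"
  assumes m: "max_common_factor X T Y S Z R \<alpha> \<beta>"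
    and W: "equicontinuous_system W Q" "factor_map X T W Q \<phi>" "factor_map Y S W Q \<psi>"
  shows "\<exists>\<eta>1 \<eta>2. factor_map Z R W Q \<eta>1 \<and> factor_map Z R W Q \<eta>2 \<and>
           (\<forall>x\<in>mspace X. \<phi> x = \<eta>1 (\<alpha> x)) \<and> (\<forall>y\<in>mspace Y. \<psi> y = \<eta>2 (\<beta> y))"
proof -
  obtain N :: "real metric" and Q' f g where N: "equicontinuous_system N Q'"
    "factor_map W Q N Q' f" "factor_map N Q' W Q g" "\<forall>x\<in>mspace W. g (f x) = x"
    using equicontinuous_system_real_copy[OF W(1)] by blast
  have "factor_map X T N Q' (f \<circ> \<phi>)" "factor_map Y S N Q' (f \<circ> \<psi>)"
    using W(2,3) N(2) by (auto intro: factor_map_compose)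
  then obtain \<eta>1 \<eta>2 where \<eta>: "factor_map Z R N Q' \<eta>1" "factor_map Z R N Q' \<eta>2"
    "\<forall>x\<in>mspace X. (f \<circ> \<phi>) x = \<eta>1 (\<alpha> x)" "\<forall>y\<in>mspace Y. (f \<circ> \<psi>) y = \<eta>2 (\<beta> y)"
    using m N(1) unfolding max_common_factor_def by blast
  have "\<forall>x\<in>mspace X. \<phi> x \<in> mspace W" "\<forall>y\<in>mspace Y. \<psi> y \<in> mspace W"
    using W(2,3) by (auto simp: factor_map_def)
  then have "\<forall>x\<in>mspace X. \<phi> x = (g \<circ> \<eta>1) (\<alpha> x)" "\<forall>y\<in>mspace Y. \<psi> y = (g \<circ> \<eta>2) (\<beta> y)"
    using \<eta>(3,4) N(4) by (metis comp_apply)+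
  then show ?thesis
    using factor_map_compose[OF \<eta>(1) N(3)] factor_map_compose[OF \<eta>(2) N(3)] by blast
qed

end

theory Submission
  imports Defs
begin

text \<open>Write \<open>P = X \<times> Y\<close>. An orbit closure \<open>E\<close> in \<open>Xeq \<times> Yeq\<close> gives rise to a common
  equicontinuous factor of \<open>X\<close> and \<open>Y\<close>, so by maximality of \<open>Z\<close> the fibres of the map induced by
  \<open>\<gamma>\<close> on \<open>Xeq \<times> Yeq\<close> are minimal. Hence a closed invariant \<open>J \<subseteq> P\<close> maps onto \<open>Xeq \<times> Yeq\<close> iff it
  meets every fibre of \<open>\<gamma>\<close>, and quasi-disjointness says that only \<open>J = P\<close> does.

  If \<open>\<gamma>\<^sup>-\<^sup>1(z)\<close> has a unique minimal subset \<open>M\<close> and \<open>J\<close> meets every fibre, then every translate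
  \<open>(T\<^sup>n \<times> id)\<^sup>-\<^sup>1 J\<close> contains \<open>M\<close>; as \<open>X\<close> and \<open>Y\<close> are minimal, \<open>J = P\<close>.

  Conversely, let \<open>G e\<close> be the open set of those \<open>z\<close> for which any two orbits in \<open>\<gamma>\<^sup>-\<^sup>1(z)\<close> come
  \<open>e\<close>-close. If \<open>G e\<close> is not dense, finitely many translates of its exterior cover \<open>Z\<close>, so the points
  whose orbits avoid a small enough neighbourhood of some \<open>v\<close> form a proper closed invariant set
  that meets every fibre. Otherwise Baire's theorem yields the residual set \<open>\<Omega>\<close>.\<close>

section \<open>Compact systems and their closed invariant sets\<close>

lemma Hausdorff_mtopology_of: "Hausdorff_space (mtopology_of X)"
  by (simp add: mtopology_of_def Metric_space.Hausdorff_space_mtopology)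

lemma continuous_map_mtopology_of_iff:
  "continuous_map (mtopology_of X) (mtopology_of Y) f \<longleftrightarrow>
     f ` mspace X \<subseteq> mspace Y \<and>
     (\<forall>a\<in>mspace X. \<forall>e>0. \<exists>d>0. \<forall>x\<in>mspace X. mdist X a x < d \<longrightarrow> mdist Y (f a) (f x) < e)"
  unfolding mtopology_of_def
    Metric_space.metric_continuous_map[OF Metric_space_mspace_mdist Metric_space_mspace_mdist]
  by (simp only: Ball_def imp_conjL)

lemma in_closure_of_mtopology_of:
  "x \<in> mtopology_of X closure_of S \<longleftrightarrow>
     x \<in> mspace X \<and> (\<forall>e>0. \<exists>y\<in>S \<inter> mspace X. mdist X x y < e)"
  by (auto simp: mtopology_of_def Metric_space.metric_closure_of[OF Metric_space_mspace_mdist]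
      Metric_space.in_mball[OF Metric_space_mspace_mdist] Bex_def)

lemma dyn_system_bij_rules:
  assumes "dyn_system X T"
  shows dyn_system_in: "x \<in> mspace X \<Longrightarrow> T x \<in> mspace X"
    and dyn_system_inv_in: "x \<in> mspace X \<Longrightarrow> inv_into (mspace X) T x \<in> mspace X"
    and dyn_system_inv: "x \<in> mspace X \<Longrightarrow> T (inv_into (mspace X) T x) = x"
    and dyn_system_inj: "T x = T y \<Longrightarrow> x \<in> mspace X \<Longrightarrow> y \<in> mspace X \<Longrightarrow> x = y"
    and dyn_system_surj: "T ` mspace X = mspace X"
  using dyn_system_bij[OF assms]
  by (auto simp: bij_betw_def inv_into_into f_inv_into_f inj_on_def)

text \<open>A continuous bijection of a compact Hausdorff space is a homeomorphism, so continuity of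
  the inverse comes for free.\<close>

lemma dyn_systemI:
  assumes "compact_space (mtopology_of X)" "bij_betw T (mspace X) (mspace X)"
    and "continuous_map (mtopology_of X) (mtopology_of X) T"
  shows "dyn_system X T"
  using assms unfolding dyn_system_def
  by (auto simp: bij_betw_def Hausdorff_mtopology_of continuous_imp_homeomorphic_map)

lemma dyn_system_compact: "dyn_system X T \<Longrightarrow> compact_space (mtopology_of X)"
  and dyn_system_continuous: "dyn_system X T \<Longrightarrow> continuous_map (mtopology_of X) (mtopology_of X) T"
  by (auto simp: dyn_system_def homeomorphic_imp_continuous_map)

lemma dyn_system_prod:
  assumes "dyn_system X T" "dyn_system Y S"
  shows "dyn_system (prod_metric X Y) (map_prod T S)"
proof (rule dyn_systemI)
  show "compact_space (mtopology_of (prod_metric X Y))"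
    using assms by (simp add: compact_space_prod_topology dyn_system_compact)
  show "bij_betw (map_prod T S) (mspace (prod_metric X Y)) (mspace (prod_metric X Y))"
    using assms by (simp add: bij_betw_map_prod dyn_system_bij)
  show "continuous_map (mtopology_of (prod_metric X Y)) (mtopology_of (prod_metric X Y)) (map_prod T S)"
    using continuous_map_compose[OF continuous_map_fst[of _ "mtopology_of Y"] dyn_system_continuous[OF assms(1)]]
      continuous_map_compose[OF continuous_map_snd[of "mtopology_of X"] dyn_system_continuous[OF assms(2)]]
    by (simp add: map_prod_def case_prod_unfold continuous_map_pairwise o_def)
qed

section \<open>Iterates over the integers\<close>

lemma ziter_0 [simp]: "ziter X T 0 x = x"
  by (simp add: ziter_def)

lemma ziter_in:
  assumes "dyn_system X T" "x \<in> mspace X"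
  shows "ziter X T n x \<in> mspace X"
proof -
  have "(T ^^ k) x \<in> mspace X" "(inv_into (mspace X) T ^^ k) x \<in> mspace X" for k
    by (induction k) (use assms in \<open>auto simp: dyn_system_in dyn_system_inv_in\<close>)
  then show ?thesis by (simp add: ziter_def)
qed

lemma ziter_add_1:
  assumes "dyn_system X T" "x \<in> mspace X"
  shows "ziter X T (n + 1) x = T (ziter X T n x)"
proof (cases "0 \<le> n")
  case True
  then show ?thesis by (simp add: ziter_def nat_add_distrib)
next
  case False
  \<comment> \<open>\<open>k\<close> counts the inverse steps at time \<open>n + 1\<close>, one
    fewer than at time \<open>n\<close>. At \<open>n = -1\<close> it is 0, and the definition of
    \<open>ziter\<close> switches to forward iterates.\<close>
  define k where "k = nat (- (n + 1))"
  have "nat (- n) = Suc k" using False by (simp add: k_def)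
  then have "ziter X T n x = inv_into (mspace X) T ((inv_into (mspace X) T ^^ k) x)"
    using False by (simp add: ziter_def)
  moreover have "ziter X T (n + 1) x = (inv_into (mspace X) T ^^ k) x"
    using False by (cases "n = -1") (auto simp: ziter_def k_def)
  ultimately have "ziter X T n x = inv_into (mspace X) T (ziter X T (n + 1) x)" by simp
  then show ?thesis using assms by (simp add: dyn_system_inv ziter_in)
qed

text \<open>A two-sided sequence that moves by \<open>T\<close> is determined by its value at 0:
  forwards by applying \<open>T\<close>, backwards by injectivity of \<open>T\<close>. The laws for
  sums, equivariant maps and products follow by exhibiting such a sequence, which avoids case
  distinctions on signs.\<close>

lemma ziter_unique:
  assumes X: "dyn_system X T"
    and f: "\<And>n. f n \<in> mspace X" "\<And>n. f (n + 1) = T (f n)"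
  shows "f n = ziter X T n (f 0)"
proof (induction n rule: int_induct[where k = 0])
  case (step1 i)
  then show ?case by (simp add: X f ziter_add_1)
next
  case (step2 i)
  have "T (f (i - 1)) = T (ziter X T (i - 1) (f 0))"
    using step2 f(2)[of "i - 1"] ziter_add_1[OF X f(1), of "i - 1" 0] by simp
  then show ?case by (rule dyn_system_inj[OF X]) (simp_all add: X f(1) ziter_in)
qed simp

lemma ziter_add:
  assumes "dyn_system X T" "x \<in> mspace X"
  shows "ziter X T (m + n) x = ziter X T m (ziter X T n x)"
proof -
  have "ziter X T (m + 1 + n) x = T (ziter X T (m + n) x)" for m
    using ziter_add_1[OF assms, of "m + n"] by (simp add: add_ac)
  then show ?thesis
    using ziter_unique[OF assms(1), of "\<lambda>m. ziter X T (m + n) x" m] assms by (simp add: ziter_in)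
qed

lemma ziter_neg:
  assumes "dyn_system X T" "x \<in> mspace X"
  shows "ziter X T (- n) (ziter X T n x) = x" "ziter X T n (ziter X T (- n) x) = x"
  using ziter_add[OF assms, of "- n" n] ziter_add[OF assms, of n "- n"] by auto

lemma ziter_equivariant:
  assumes "dyn_system X T" "dyn_system Y S" "f ` mspace X \<subseteq> mspace Y"
    and "\<And>x. x \<in> mspace X \<Longrightarrow> f (T x) = S (f x)" and "x \<in> mspace X"
  shows "f (ziter X T n x) = ziter Y S n (f x)"
proof -
  have "f (ziter X T n x) \<in> mspace Y" for n
    using assms(3) ziter_in[OF assms(1,5)] by blast
  moreover have "f (ziter X T (n + 1) x) = S (f (ziter X T n x))" for n
    using assms(4)[OF ziter_in[OF assms(1,5)]] ziter_add_1[OF assms(1,5)] by simp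
  ultimately show ?thesis
    using ziter_unique[OF assms(2), of "\<lambda>n. f (ziter X T n x)" n] by simp
qed

lemma ziter_prod:
  assumes "dyn_system X T" "dyn_system Y S" "p \<in> mspace (prod_metric X Y)"
  shows "ziter (prod_metric X Y) (map_prod T S) n p = (ziter X T n (fst p), ziter Y S n (snd p))"
proof -
  have p: "fst p \<in> mspace X" "snd p \<in> mspace Y" using assms(3) by auto
  show ?thesis
    using ziter_unique[OF dyn_system_prod[OF assms(1,2)],
        of "\<lambda>n. (ziter X T n (fst p), ziter Y S n (snd p))" n]
    by (simp add: ziter_in[OF assms(1)] ziter_in[OF assms(2)] ziter_add_1[OF assms(1)]
        ziter_add_1[OF assms(2)] p)
qed

lemma continuous_map_ziter:
  assumes X: "dyn_system X T"
  shows "continuous_map (mtopology_of X) (mtopology_of X) (ziter X T n)"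
proof -
  let ?X = "mtopology_of X"
  obtain g where "homeomorphic_maps ?X ?X T g"
    using X by (auto simp: dyn_system_def homeomorphic_map_maps)
  then have g: "continuous_map ?X ?X g" "\<And>x. x \<in> mspace X \<Longrightarrow> T (g x) = x"
    by (auto simp: homeomorphic_maps_def)
  then have "g x \<in> mspace X" if "x \<in> mspace X" for x
    using that by (auto simp: continuous_map_def Pi_iff)
  \<comment> \<open>Negative iterates use \<open>inv_into\<close>; it agrees with the continuous
    inverse \<open>g\<close> on the carrier, which is enough to transfer continuity.\<close>
  then have "g x = inv_into (mspace X) T x" if "x \<in> mspace X" for x
    using that g(2)
    by (metis dyn_system_inj[OF X] dyn_system_inv[OF X] dyn_system_inv_in[OF X])
  then have inv: "continuous_map ?X ?X (inv_into (mspace X) T)"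
    using g(1) by (elim continuous_map_eq) auto
  have "continuous_map ?X ?X (f ^^ k)" if "continuous_map ?X ?X f" for f k
  proof (induction k)
    case (Suc k)
    show ?case using continuous_map_compose[OF Suc that] by (simp add: o_def)
  qed (simp add: id_def)
  from this[OF inv] this[OF dyn_system_continuous[OF X]]
  show ?thesis by (simp add: ziter_def)
qed

section \<open>Closed invariant sets and orbit closures\<close>

lemma closed_invariant_iff:
  assumes "dyn_system X T"
  shows "closed_invariant X T C \<longleftrightarrow>
    closedin (mtopology_of X) C \<and> (\<forall>x\<in>mspace X. T x \<in> C \<longleftrightarrow> x \<in> C)"
proof (cases "closedin (mtopology_of X) C")
  case True
  then have "C \<subseteq> mspace X" using closedin_subset by fastforce
  \<comment> \<open>\<open>T\<close> is a bijection of the carrier, so invariance becomes membership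
    transported both ways. In this form it passes directly to intersections and preimages.\<close>
  then have "T ` C = C \<longleftrightarrow> (\<forall>x\<in>mspace X. T x \<in> C \<longleftrightarrow> x \<in> C)"
    using dyn_system_inj[OF assms] dyn_system_surj[OF assms]
    by (auto simp: set_eq_iff image_iff subset_iff) metis+
  then show ?thesis by (simp add: closed_invariant_def)
qed (simp add: closed_invariant_def)

lemma closed_invariant_subset: "closed_invariant X T C \<Longrightarrow> C \<subseteq> mspace X"
  using closedin_subset by (fastforce simp: closed_invariant_def)

lemma closed_invariant_Int:
  assumes "dyn_system X T" "closed_invariant X T C" "closed_invariant X T D"
  shows "closed_invariant X T (C \<inter> D)"
  using assms by (auto simp: closed_invariant_iff)

lemma closed_invariant_preimage:
  assumes "dyn_system X T" "dyn_system Y S" "closed_invariant Y S C"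
    and "continuous_map (mtopology_of X) (mtopology_of Y) f"
    and "\<And>x. x \<in> mspace X \<Longrightarrow> f (T x) = S (f x)"
  shows "closed_invariant X T {x \<in> mspace X. f x \<in> C}"
  using assms closedin_continuous_map_preimage[OF assms(4), of C]
  by (auto simp: closed_invariant_iff dyn_system_in[OF assms(1)] continuous_map_def Pi_iff)

text \<open>The image of a compact set is compact, hence closed in a Hausdorff space.\<close>

lemma closed_invariant_image:
  assumes "dyn_system X T" "closed_invariant X T C"
    and f: "continuous_map (mtopology_of X) (mtopology_of Y) f"
    and "\<And>x. x \<in> mspace X \<Longrightarrow> f (T x) = S (f x)"
  shows "closed_invariant Y S (f ` C)"
proof -
  have "compactin (mtopology_of X) C"
    using assms by (auto simp: closed_invariant_def closedin_compact_space dyn_system_compact)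
  then have "closedin (mtopology_of Y) (f ` C)"
    using f image_compactin compactin_imp_closedin Hausdorff_mtopology_of by blast
  moreover have "S ` f ` C = f ` T ` C"
    using closed_invariant_subset[OF assms(2)] assms(4) by (force simp: image_iff)
  ultimately show ?thesis using assms(2) by (simp add: closed_invariant_def)
qed

lemma closed_invariant_ziter:
  assumes X: "dyn_system X T" and C: "closed_invariant X T C" and x: "x \<in> mspace X"
  shows "ziter X T n x \<in> C \<longleftrightarrow> x \<in> C"
proof -
  have "ziter X T (n + 1) x \<in> C \<longleftrightarrow> ziter X T n x \<in> C" for n
    using C X x by (simp add: ziter_add_1 closed_invariant_iff ziter_in)
  from this this[of "_ - 1"] show ?thesis
    by (induction n rule: int_induct[where k = 0]) auto
qed

lemma zorbit_subset:
  assumes "dyn_system X T" "x \<in> mspace X"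
  shows "zorbit X T x \<subseteq> mspace X"
  using assms by (auto simp: zorbit_def ziter_in)

lemma orbit_closure_subset:
  assumes "dyn_system X T" "closed_invariant X T C" "x \<in> C"
  shows "mtopology_of X closure_of zorbit X T x \<subseteq> C"
proof (rule closure_of_minimal)
  show "zorbit X T x \<subseteq> C"
    using assms closed_invariant_subset[OF assms(2)] by (auto simp: zorbit_def closed_invariant_ziter)
qed (use assms in \<open>simp add: closed_invariant_def\<close>)

lemma orbit_closure_closed_invariant:
  assumes X: "dyn_system X T" and x: "x \<in> mspace X"
  shows "closed_invariant X T (mtopology_of X closure_of zorbit X T x)"
proof -
  have "T ` zorbit X T x = zorbit X T x"
  proof -
    have "T (ziter X T n x) = ziter X T (n + 1) x" for n using X x by (simp add: ziter_add_1)
    moreover have "ziter X T n x = T (ziter X T (n - 1) x)" for n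
      using ziter_add_1[OF X x, of "n - 1"] by simp
    ultimately show ?thesis unfolding zorbit_def by blast
  qed
  then show ?thesis
    using homeomorphic_map_closure_of[of "mtopology_of X" "mtopology_of X" T "zorbit X T x"]
      zorbit_subset[OF X x] X
    by (simp add: closed_invariant_def dyn_system_def)
qed

lemma orbit_closure_self:
  assumes "dyn_system X T" "x \<in> mspace X"
  shows "x \<in> mtopology_of X closure_of zorbit X T x"
proof -
  have "x \<in> zorbit X T x" unfolding zorbit_def by (metis (mono_tags) mem_Collect_eq ziter_0)
  then show ?thesis
    using closure_of_subset[of "zorbit X T x" "mtopology_of X"] zorbit_subset[OF assms] by auto
qed

section \<open>Minimal systems and minimal subsets\<close>

lemma minimal_system_closed_invariant:
  assumes "minimal_system X T" "closed_invariant X T C" "C \<noteq> {}"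
  shows "C = mspace X"
  using assms orbit_closure_subset[of X T C] closed_invariant_subset[of X T C]
  unfolding minimal_system_def by blast

lemma minimal_systemI:
  assumes "dyn_system X T"
    and "\<And>C. closed_invariant X T C \<Longrightarrow> C \<noteq> {} \<Longrightarrow> C = mspace X"
  shows "minimal_system X T"
  using assms orbit_closure_closed_invariant orbit_closure_self unfolding minimal_system_def by fast

lemma minimal_system_dyn: "minimal_system X T \<Longrightarrow> dyn_system X T"
  by (simp add: minimal_system_def)

lemma minimal_system_factor:
  assumes X: "minimal_system X T" and Y: "dyn_system Y S" and f: "factor_map X T Y S f"
  shows "minimal_system Y S"
proof (rule minimal_systemI[OF Y])
  fix C assume C: "closed_invariant Y S C" "C \<noteq> {}"
  have "closed_invariant X T {x \<in> mspace X. f x \<in> C}"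
    using f closed_invariant_preimage[OF minimal_system_dyn[OF X] Y C(1)] by (simp add: factor_map_def)
  moreover have "{x \<in> mspace X. f x \<in> C} \<noteq> {}"
    using C f closed_invariant_subset[OF C(1)] by (force simp: factor_map_def)
  ultimately have "{x \<in> mspace X. f x \<in> C} = mspace X"
    using X minimal_system_closed_invariant by blast
  then show "C = mspace Y"
  proof -
    have "f ` mspace X \<subseteq> C" using \<open>{x \<in> mspace X. f x \<in> C} = mspace X\<close> by blast
    then show ?thesis using f closed_invariant_subset[OF C(1)] by (simp add: factor_map_def)
  qed
qed

text \<open>Zorn's lemma applies to the nonempty closed invariant subsets of \<open>C\<close>: along
  a chain their intersection is nonempty by compactness. An inclusion-minimal such set contains the
  orbit closure of each of its points, and so equals it.\<close>

lemma minimal_subset_exists: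
  assumes X: "dyn_system X T" and C: "closed_invariant X T C" "C \<noteq> {}"
  shows "\<exists>M\<subseteq>C. minimal_subset X T M"
proof -
  \<comment> \<open>Complements are used because \<open>subset_Zorn_nonempty\<close> yields maximal
    elements and asks for unions of chains.\<close>
  define A where "A = {mspace X - D | D. closed_invariant X T D \<and> D \<noteq> {} \<and> D \<subseteq> C}"
  have A_iff: "U \<in> A \<longleftrightarrow> U \<subseteq> mspace X \<and> closed_invariant X T (mspace X - U) \<and>
      mspace X - U \<noteq> {} \<and> mspace X - U \<subseteq> C" for U
    unfolding A_def using closed_invariant_subset double_diff by (smt (verit) Diff_subset mem_Collect_eq subset_refl)
  have "\<Union>\<C> \<in> A" if ne: "\<C> \<noteq> {}" and ch: "subset.chain A \<C>" for \<C>
  proof -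
    let ?D = "(\<lambda>U. mspace X - U) ` \<C>"
    have sub: "\<C> \<subseteq> A" and lin: "\<And>U V. U \<in> \<C> \<Longrightarrow> V \<in> \<C> \<Longrightarrow> U \<subseteq> V \<or> V \<subseteq> U"
      using ch by (auto simp: subset_chain_def)
    have D: "closed_invariant X T D" "D \<noteq> {}" "D \<subseteq> C" if "D \<in> ?D" for D
      using that sub A_iff by blast+
    have "\<Inter>\<F> \<noteq> {}" if "finite \<F>" "\<F> \<subseteq> ?D" for \<F>
    proof (cases "\<F> = {}")
      case False
      \<comment> \<open>A finite chain attains its intersection, so the finite intersection property
        holds.\<close>
      have "\<Inter>\<F> \<in> \<F>"
      proof (rule finite_Inf_in[OF that(1) False])
        show "inf D E \<in> \<F>" if "D \<in> \<F>" "E \<in> \<F>" for D E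
        proof -
          have "D \<subseteq> E \<or> E \<subseteq> D" using that \<open>\<F> \<subseteq> ?D\<close> lin by blast
          then show ?thesis using that by (auto simp: inf_absorb1 inf_absorb2)
        qed
      qed
      then show ?thesis using that(2) D(2) by blast
    qed simp
    moreover have "closedin (mtopology_of X) D" if "D \<in> ?D" for D
      using D(1)[OF that] by (simp add: closed_invariant_def)
    ultimately have "\<Inter>?D \<noteq> {}"
      using dyn_system_compact[OF X] unfolding compact_space_fip by meson
    moreover have eq: "mspace X - \<Union>\<C> = \<Inter>?D" using ne by auto
    moreover have "closed_invariant X T (\<Inter>?D)"
    proof -
      have "closedin (mtopology_of X) (\<Inter>?D)"
        using D(1) ne by (intro closedin_Inter) (auto simp: closed_invariant_def)
      moreover have "\<forall>x\<in>mspace X. T x \<in> \<Inter>?D \<longleftrightarrow> x \<in> \<Inter>?D"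
        using D(1) unfolding closed_invariant_iff[OF X] by blast
      ultimately show ?thesis by (simp only: closed_invariant_iff[OF X])
    qed
    moreover have "\<Inter>?D \<subseteq> C" using ne D(3) by blast
    moreover have "\<Union>\<C> \<subseteq> mspace X" using sub A_iff by blast
    ultimately show ?thesis unfolding A_iff by (simp only: eq simp_thms)
  qed
  moreover have "A \<noteq> {}" using C unfolding A_def by blast
  ultimately have "\<exists>U\<in>A. \<forall>V\<in>A. U \<subseteq> V \<longrightarrow> V = U"
    by (intro subset_Zorn_nonempty)
  then obtain U where U: "U \<in> A" and max: "\<And>V. V \<in> A \<Longrightarrow> U \<subseteq> V \<Longrightarrow> V = U"
    by blast
  define M where "M = mspace X - U"
  have M: "closed_invariant X T M" "M \<noteq> {}" "M \<subseteq> C" using U A_iff by (auto simp: M_def)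
  have "mtopology_of X closure_of zorbit X T x = M" if "x \<in> M" for x
  proof -
    let ?D = "mtopology_of X closure_of zorbit X T x"
    have x: "x \<in> mspace X" using that by (simp add: M_def)
    have D: "?D \<subseteq> M" using orbit_closure_subset[OF X M(1) that] .
    have "mspace X - ?D \<in> A"
      unfolding A_def
      using orbit_closure_closed_invariant[OF X x] orbit_closure_self[OF X x] D M(3) by blast
    moreover have "U \<subseteq> mspace X - ?D" using D U A_iff by (auto simp: M_def)
    ultimately have "mspace X - ?D = U" using max by blast
    then show ?thesis using D closed_invariant_subset[OF M(1)] by (auto simp: M_def)
  qed
  then show ?thesis using M unfolding minimal_subset_def by blast
qed

section \<open>Common factors from orbit closures of equicontinuous systems\<close>

lemma mdist_self: "x \<in> mspace X \<Longrightarrow> mdist X x x = 0"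
  by simp

text \<open>\<open>D\<close> is any function of two points, so this serves metrics and pseudometrics
  alike.\<close>

lemma ziter_isometry:
  assumes A: "dyn_system A s"
    and inv: "\<And>x y. x \<in> mspace A \<Longrightarrow> y \<in> mspace A \<Longrightarrow> D (s x) (s y) = D x y"
    and xy: "x \<in> mspace A" "y \<in> mspace A"
  shows "D (ziter A s n x) (ziter A s n y) = D x y"
proof -
  have "D (ziter A s (n + 1) x) (ziter A s (n + 1) y) = D (ziter A s n x) (ziter A s n y)" for n
    using ziter_add_1[OF A xy(1)] ziter_add_1[OF A xy(2)] inv ziter_in[OF A] xy by simp
  from this this[of "_ - 1"] show ?thesis
    by (induction n rule: int_induct[where k = 0]) auto
qed

lemma topology_eq_if_continuous_id:
  assumes "continuous_map X Y id" "continuous_map Y X id"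
  shows "X = Y"
proof -
  have top: "topspace X = topspace Y"
    using assms by (auto simp: continuous_map_def Pi_iff)
  have "openin X U \<longleftrightarrow> openin Y U" for U
    using openin_continuous_map_preimage[OF assms(1), of U]
      openin_continuous_map_preimage[OF assms(2), of U] openin_subset[of X U] openin_subset[of Y U] top
    by (metis (mono_tags, lifting) Collect_cong Collect_mem_eq id_apply subsetD)
  then show ?thesis by (simp add: topology_eq)
qed

text \<open>The supremum of the distances along two orbits does not change when both orbits are
  shifted. Equicontinuity is what keeps the topology of this new metric the same.\<close>

lemma equicontinuous_invariant_metric:
  fixes A :: "'a metric"
  assumes A: "equicontinuous_system A s"
  shows "\<exists>A' :: 'a metric. mspace A' = mspace A \<and> mtopology_of A' = mtopology_of A \<and>
    (\<forall>x\<in>mspace A. \<forall>y\<in>mspace A. mdist A' (s x) (s y) = mdist A' x y)"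
proof -
  have dyn: "dyn_system A s" using A by (simp add: equicontinuous_system_def)
  \<comment> \<open>Truncating at 1 bounds the family, so that the supremum exists.\<close>
  define F where "F x y n = min 1 (mdist A (ziter A s n x) (ziter A s n y))" for x y n
  define D where "D x y = (SUP n. F x y n)" for x y
  have bdd: "bdd_above (range (F x y))" for x y
    by (rule bdd_aboveI[of _ 1]) (auto simp: F_def)
  have F_le: "F x y n \<le> D x y" for x y n
    unfolding D_def by (rule cSUP_upper[OF _ bdd]) simp
  have D_le: "D x y \<le> c" if "\<And>n. F x y n \<le> c" for x y c
    unfolding D_def by (rule cSUP_least) (use that in auto)
  have F_nonneg: "0 \<le> F x y n" for x y n by (simp add: F_def)
  have zero: "D x y = 0 \<longleftrightarrow> x = y" if "x \<in> mspace A" "y \<in> mspace A" for x y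
  proof
    assume "D x y = 0"
    then have "F x y 0 = 0" using F_le[of x y 0] F_nonneg[of x y 0] by simp
    then have "mdist A x y = 0" unfolding F_def ziter_0 by linarith
    then show "x = y" using that by (simp add: mdist_zero)
  next
    assume "x = y"
    then have "F x y n = 0" for n using that by (simp add: F_def mdist_self ziter_in[OF dyn])
    then show "D x y = 0" by (simp add: D_def)
  qed
  have tri: "D x z \<le> D x y + D y z" if "x \<in> mspace A" "y \<in> mspace A" "z \<in> mspace A" for x y z
  proof (rule D_le)
    fix n
    have "F x z n \<le> F x y n + F y z n"
      using mdist_triangle[of "ziter A s n x" A "ziter A s n y" "ziter A s n z"] that
      by (auto simp: F_def ziter_in[OF dyn] min_def)
        (smt (verit) mdist_nonneg)+
    then show "F x z n \<le> D x y + D y z" using F_le[of x y n] F_le[of y z n] by linarith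
  qed
  interpret M: Metric_space "mspace A" D
    by unfold_locales
      (use zero tri order_trans[OF F_nonneg F_le] in \<open>auto simp: D_def F_def mdist_commute\<close>)
  define A' where "A' = metric (mspace A, D)"
  have A': "mspace A' = mspace A" "mdist A' = D" by (simp_all add: A'_def)
  have "continuous_map (mtopology_of A') (mtopology_of A) id"
    unfolding continuous_map_mtopology_of_iff
  proof (intro conjI ballI allI impI)
    fix x e assume x: "x \<in> mspace A'" "0 < (e::real)"
    \<comment> \<open>Below 1 the truncation has no effect, hence \<open>min 1 e\<close>; the term
      \<open>n = 0\<close> of the supremum is the original distance.\<close>
    have "mdist A x y < e" if "D x y < min 1 e" for y
      using F_le[of x y 0] that unfolding F_def ziter_0 by linarith
    then show "\<exists>d>0. \<forall>y\<in>mspace A'. mdist A' x y < d \<longrightarrow> mdist A (id x) (id y) < e"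
      using x by (intro exI[of _ "min 1 e"]) (auto simp: A')
  qed (simp add: A')
  moreover have "continuous_map (mtopology_of A) (mtopology_of A') id"
    unfolding continuous_map_mtopology_of_iff
  proof (intro conjI ballI allI impI)
    fix x e assume x: "x \<in> mspace A" "0 < (e::real)"
    then obtain d where d: "d > 0" "\<And>y n. y \<in> mspace A \<Longrightarrow> mdist A x y < d \<Longrightarrow>
        mdist A (ziter A s n x) (ziter A s n y) < e / 2"
      using A unfolding equicontinuous_system_def by (meson half_gt_zero)
    have "D x y < e" if "y \<in> mspace A" "mdist A x y < d" for y
    proof -
      \<comment> \<open>A supremum of terms below \<open>e / 2\<close> is only known to be at most
        \<open>e / 2\<close>; the halving makes it strictly less than \<open>e\<close>.\<close>
      have "F x y n \<le> e / 2" for n using d(2)[OF that, of n] by (auto simp: F_def)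
      then show ?thesis using D_le[of x y "e / 2"] x(2) by fastforce
    qed
    then show "\<exists>d>0. \<forall>y\<in>mspace A. mdist A x y < d \<longrightarrow> mdist A' (id x) (id y) < e"
      using d(1) by (auto simp: A')
  qed (simp add: A')
  ultimately have "mtopology_of A' = mtopology_of A" by (rule topology_eq_if_continuous_id)
  moreover have "D (s x) (s y) = D x y" if "x \<in> mspace A" "y \<in> mspace A" for x y
  proof -
    have "ziter A s n (s z) = ziter A s (n + 1) z" if "z \<in> mspace A" for n z
      using ziter_add[OF dyn that, of n 1] ziter_add_1[OF dyn that, of 0] by simp
    \<comment> \<open>Applying \<open>s\<close> to both points shifts the index by one, which merely
      permutes a family indexed by all integers.\<close>
    then have F: "F (s x) (s y) = F x y \<circ> (\<lambda>n. n + 1)" using that by (auto simp: F_def)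
    have "range (F x y \<circ> (\<lambda>n. n + 1)) = range (F x y)"
      unfolding image_comp[symmetric] by (simp only: surj_plus_right)
    then show ?thesis unfolding D_def F by simp
  qed
  ultimately show ?thesis using A' by metis
qed

text \<open>Points at pseudodistance 0 are identified. By \<open>cont\<close> the quotient map is
  continuous, so the quotient is compact; by \<open>inv\<close> the induced map preserves its
  distances, so it is equicontinuous.\<close>

lemma pseudometric_quotient_system:
  fixes A :: "'a metric" and D :: "'a \<Rightarrow> 'a \<Rightarrow> real"
  assumes A: "dyn_system A s"
    and zero: "\<And>x. x \<in> mspace A \<Longrightarrow> D x x = 0"
    and sym: "\<And>x y. x \<in> mspace A \<Longrightarrow> y \<in> mspace A \<Longrightarrow> D x y = D y x"
    and tri: "\<And>x y z. x \<in> mspace A \<Longrightarrow> y \<in> mspace A \<Longrightarrow> z \<in> mspace A \<Longrightarrow> D x z \<le> D x y + D y z"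
    and inv: "\<And>x y. x \<in> mspace A \<Longrightarrow> y \<in> mspace A \<Longrightarrow> D (s x) (s y) = D x y"
    and cont: "\<And>x e. x \<in> mspace A \<Longrightarrow> 0 < e \<Longrightarrow> \<exists>d>0. \<forall>y\<in>mspace A. mdist A x y < d \<longrightarrow> D x y < e"
  shows "\<exists>(W :: 'a set metric) Q f. equicontinuous_system W Q \<and> factor_map A s W Q f \<and>
    (\<forall>x\<in>mspace A. \<forall>y\<in>mspace A. mdist W (f x) (f y) = D x y)"
proof -
  let ?M = "mspace A"
  have nonneg: "0 \<le> D x y" if "x \<in> ?M" "y \<in> ?M" for x y
    using zero[OF that(1)] sym[OF that] tri[OF that(1,2,1)] by linarith
  \<comment> \<open>\<open>f x\<close> is the class of \<open>x\<close>, and \<open>r\<close> picks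
    a representative of a class.\<close>
  define f where "f x = {y \<in> ?M. D x y = 0}" for x
  define r where "r c = (SOME y. y \<in> c)" for c :: "'a set"
  have r: "r (f x) \<in> ?M" "D x (r (f x)) = 0" if "x \<in> ?M" for x
  proof -
    have "x \<in> f x" using that zero by (simp add: f_def)
    then have "r (f x) \<in> f x" unfolding r_def by (rule someI)
    then show "r (f x) \<in> ?M" "D x (r (f x)) = 0" by (auto simp: f_def)
  qed
  have D_cong: "D x y = D x' y'"
    if "x \<in> ?M" "x' \<in> ?M" "y \<in> ?M" "y' \<in> ?M" "D x x' = 0" "D y y' = 0" for x x' y y'
    using tri[of x x' y] tri[of x' x y] tri[of x' y y'] tri[of x' y' y] sym[of x x'] sym[of y y'] that
    by linarith
  have f_eq: "f x = f y \<longleftrightarrow> D x y = 0" if "x \<in> ?M" "y \<in> ?M" for x y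
  proof
    assume "f x = f y"
    moreover have "y \<in> f y" using that zero by (simp add: f_def)
    ultimately show "D x y = 0" by (auto simp: f_def)
  next
    assume 0: "D x y = 0"
    have "D x z = D y z" if "z \<in> ?M" for z
      using D_cong[of x y z z] 0 that \<open>x \<in> ?M\<close> \<open>y \<in> ?M\<close> zero by simp
    then show "f x = f y" by (auto simp: f_def)
  qed
  \<comment> \<open>The value 0 off the carrier keeps \<open>D'\<close> nonnegative and symmetric
    for all arguments, as \<open>Metric_space\<close> demands.\<close>
  define D' where "D' c c' = (if c \<in> f ` ?M \<and> c' \<in> f ` ?M then D (r c) (r c') else 0)" for c c'
  have D'f: "D' (f x) (f y) = D x y" if "x \<in> ?M" "y \<in> ?M" for x y
    using that D_cong[of x "r (f x)" y "r (f y)"] r by (simp add: D'_def)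
  interpret W: Metric_space "f ` ?M" D'
  proof
    show "0 \<le> D' c c'" for c c' using nonneg r by (auto simp: D'_def)
    show "D' c c' = D' c' c" for c c' using sym r by (auto simp: D'_def)
    show "D' c c' = 0 \<longleftrightarrow> c = c'" if cc: "c \<in> f ` ?M" "c' \<in> f ` ?M" for c c'
    proof -
      obtain x y where "x \<in> ?M" "y \<in> ?M" "c = f x" "c' = f y" using cc by blast
      then show ?thesis by (simp add: D'f f_eq)
    qed
    show "D' c c'' \<le> D' c c' + D' c' c''"
      if "c \<in> f ` ?M" "c' \<in> f ` ?M" "c'' \<in> f ` ?M" for c c' c''
      using that by (auto simp: D'f intro!: tri)
  qed
  define W where "W = metric (f ` ?M, D')"
  have W: "mspace W = f ` ?M" "mdist W = D'" by (simp_all add: W_def)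
  define Q where "Q c = f (s (r c))" for c
  note s_in = dyn_system_in[OF A]
  have Qf: "Q (f x) = f (s x)" if "x \<in> ?M" for x
    using that r[OF that] inv[of x "r (f x)"] f_eq[of "s x" "s (r (f x))"] by (simp add: Q_def s_in)
  have contf: "continuous_map (mtopology_of A) (mtopology_of W) f"
    unfolding continuous_map_mtopology_of_iff W using cont by (auto simp: D'f)
  have "mspace W = f ` topspace (mtopology_of A)" by (simp add: W)
  then have "compact_space (mtopology_of W)"
    using image_compactin[OF _ contf] dyn_system_compact[OF A] by (metis compact_space_def topspace_mtopology_of)
  moreover have "bij_betw Q (mspace W) (mspace W)"
    unfolding bij_betw_def
  proof
    show "inj_on Q (mspace W)"
      by (auto simp: inj_on_def W Qf f_eq s_in inv)
    have "f x \<in> Q ` f ` ?M" if "x \<in> ?M" for x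
    proof -
      from that have "x \<in> s ` ?M" using dyn_system_surj[OF A] by simp
      then obtain y where "y \<in> ?M" "x = s y" by blast
      then show ?thesis using Qf[of y] by (intro image_eqI[of _ _ "f y"]) simp_all
    qed
    then show "Q ` mspace W = mspace W" by (auto simp: W Qf s_in)
  qed
  moreover have "continuous_map (mtopology_of W) (mtopology_of W) Q"
    unfolding continuous_map_mtopology_of_iff W by (auto simp: Qf s_in D'f inv)
  ultimately have dynW: "dyn_system W Q" by (intro dyn_systemI)
  have "mdist W (ziter W Q n (f x)) (ziter W Q n (f y)) = mdist W (f x) (f y)"
    if "x \<in> ?M" "y \<in> ?M" for n x y
    using that ziter_equivariant[OF A dynW, of f, symmetric]
    by (simp add: W Qf D'f ziter_in[OF A] ziter_isometry[where D = D, OF A inv])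
  then have "equicontinuous_system W Q"
    unfolding equicontinuous_system_def using dynW by (auto simp: W)
  moreover have "factor_map A s W Q f" unfolding factor_map_def using contf by (simp add: W Qf)
  ultimately show ?thesis using D'f W(2) by metis
qed

section \<open>Orbit closures in products\<close>

lemma fst_closed_invariant:
  assumes X: "minimal_system X T" and Y: "dyn_system Y S"
    and C: "closed_invariant (prod_metric X Y) (map_prod T S) C" "C \<noteq> {}"
  shows "fst ` C = mspace X"
  using minimal_system_closed_invariant[OF X] C
    closed_invariant_image[OF dyn_system_prod[OF minimal_system_dyn[OF X] Y] C(1), of X fst T]
  by (simp add: continuous_map_fst)

lemma snd_closed_invariant:
  assumes X: "dyn_system X T" and Y: "minimal_system Y S"
    and C: "closed_invariant (prod_metric X Y) (map_prod T S) C" "C \<noteq> {}"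
  shows "snd ` C = mspace Y"
  using minimal_system_closed_invariant[OF Y] C
    closed_invariant_image[OF dyn_system_prod[OF X minimal_system_dyn[OF Y]] C(1), of Y snd S]
  by (simp add: continuous_map_snd)

text \<open>The product metric is comparable with the two coordinate distances, but both coordinates
  must be approximated at one common time \<open>n\<close>.\<close>

lemma in_closure_of_zorbit_prod:
  assumes A: "dyn_system A s" and B: "dyn_system B t"
    and pts: "a\<^sub>0 \<in> mspace A" "b\<^sub>0 \<in> mspace B" "a \<in> mspace A" "b \<in> mspace B"
  shows "(a, b) \<in> mtopology_of (prod_metric A B) closure_of
        zorbit (prod_metric A B) (map_prod s t) (a\<^sub>0, b\<^sub>0) \<longleftrightarrow>
     (\<forall>e>0. \<exists>n. mdist A a (ziter A s n a\<^sub>0) < e \<and> mdist B b (ziter B t n b\<^sub>0) < e)"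
    (is "?L \<longleftrightarrow> ?R")
proof -
  interpret Metric_space12 "mspace A" "mdist A" "mspace B" "mdist B"
    by (rule Metric_space12_mspace_mdist)
  have in_AB: "ziter A s n a\<^sub>0 \<in> mspace A" "ziter B t n b\<^sub>0 \<in> mspace B" for n
    using ziter_in[OF A pts(1)] ziter_in[OF B pts(2)] .
  have "?L \<longleftrightarrow> (\<forall>e>0. \<exists>n. prod_dist (mdist A) (mdist B) (a, b) (ziter A s n a\<^sub>0, ziter B t n b\<^sub>0) < e)"
    unfolding in_closure_of_mtopology_of zorbit_def using pts in_AB
    by (auto simp: ziter_prod[OF A B] Bex_def) blast
  also have "\<dots> \<longleftrightarrow> ?R"
  proof (intro iffI allI impI)
    fix e :: real
    assume "\<forall>e>0. \<exists>n. prod_dist (mdist A) (mdist B) (a, b) (ziter A s n a\<^sub>0, ziter B t n b\<^sub>0) < e" "0 < e"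
    then show "\<exists>n. mdist A a (ziter A s n a\<^sub>0) < e \<and> mdist B b (ziter B t n b\<^sub>0) < e"
      using component_le_prod_metric order_le_less_trans by metis
  next
    fix e :: real
    assume "?R" "0 < e"
    then obtain n where "mdist A a (ziter A s n a\<^sub>0) < e / 2" "mdist B b (ziter B t n b\<^sub>0) < e / 2"
      by (meson half_gt_zero)
    then have "prod_dist (mdist A) (mdist B) (a, b) (ziter A s n a\<^sub>0, ziter B t n b\<^sub>0) < e"
      using prod_metric_le_components[of a "ziter A s n a\<^sub>0" b "ziter B t n b\<^sub>0"] pts in_AB
      by (smt (verit) field_sum_of_halves)
    then show "\<exists>n. prod_dist (mdist A) (mdist B) (a, b) (ziter A s n a\<^sub>0, ziter B t n b\<^sub>0) < e" ..
  qed
  finally show ?thesis .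
qed

text \<open>Two points of \<open>A\<close> are identified when iterates of one approach the other
  along times that return \<open>b\<^sub>0\<close> to itself in the limit. For group rotations with
  identities \<open>a\<^sub>0\<close> and \<open>b\<^sub>0\<close>, \<open>E\<close> is a closed
  subgroup, and this is the quotient of \<open>A\<close> by the subgroup of all \<open>a\<close>
  with \<open>(a, b\<^sub>0) \<in> E\<close>. A point \<open>b\<close> is then sent to the class
  formed by all \<open>a\<close> with \<open>(a, b) \<in> E\<close>.\<close>

lemma isometric_orbit_closure_common_factor:
  fixes A :: "'a metric" and B :: "'b metric"
  assumes A: "minimal_system A s" and B: "minimal_system B t"
    and isoA: "\<And>x y. x \<in> mspace A \<Longrightarrow> y \<in> mspace A \<Longrightarrow> mdist A (s x) (s y) = mdist A x y"
    and isoB: "\<And>x y. x \<in> mspace B \<Longrightarrow> y \<in> mspace B \<Longrightarrow> mdist B (t x) (t y) = mdist B x y"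
    and a0: "a\<^sub>0 \<in> mspace A" and b0: "b\<^sub>0 \<in> mspace B"
  defines "E \<equiv> mtopology_of (prod_metric A B) closure_of
                 zorbit (prod_metric A B) (map_prod s t) (a\<^sub>0, b\<^sub>0)"
  shows "\<exists>(W :: 'a set metric) Q f g. equicontinuous_system W Q \<and>
    factor_map A s W Q f \<and> factor_map B t W Q g \<and>
    (\<forall>a\<in>mspace A. \<forall>b\<in>mspace B. f a = g b \<longleftrightarrow> (a, b) \<in> E)"
proof -
  have dA: "dyn_system A s" and dB: "dyn_system B t"
    using A B by (simp_all add: minimal_system_dyn)
  let ?\<sigma> = "ziter A s" and ?\<tau> = "ziter B t"
  note zA = ziter_in[OF dA] and zB = ziter_in[OF dB]
  have isoA': "mdist A (?\<sigma> n x) (?\<sigma> n y) = mdist A x y" if "x \<in> mspace A" "y \<in> mspace A" for n x y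
    by (rule ziter_isometry[where D = "mdist A", OF dA isoA that])
  have isoB': "mdist B (?\<tau> n x) (?\<tau> n y) = mdist B x y" if "x \<in> mspace B" "y \<in> mspace B" for n x y
    by (rule ziter_isometry[where D = "mdist B", OF dB isoB that])
  note triA = mdist_triangle[where m = A] and triB = mdist_triangle[where m = B]
  \<comment> \<open>\<open>u k\<close> measures how far \<open>k\<close> steps move
    \<open>b\<^sub>0\<close>. It is even and subadditive, which makes \<open>D\<close> below
    symmetric and gives it the triangle inequality.\<close>
  define u where "u k = mdist B b\<^sub>0 (?\<tau> k b\<^sub>0)" for k
  have u_diff: "mdist B (?\<tau> n b\<^sub>0) (?\<tau> m b\<^sub>0) = u (m - n)" for n m
    using isoB'[OF b0 zB[OF b0], of n "m - n"] ziter_add[OF dB b0, of n "m - n"]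
    by (simp add: u_def)
  have u_neg: "u (- k) = u k" for k
    using u_diff[of k 0] by (simp add: u_def mdist_commute)
  have u_add: "u (k + l) \<le> u k + u l" for k l
    using triB[of b\<^sub>0 "?\<tau> k b\<^sub>0" "?\<tau> (k + l) b\<^sub>0"] u_diff[of k "k + l"] b0 zB by (simp add: u_def)
  have u0: "u 0 = 0" and u_nonneg: "0 \<le> u k" for k
    using mdist_self[of b\<^sub>0 B] b0 by (simp_all add: u_def)

  \<comment> \<open>\<open>D\<close> is the least cost of getting from \<open>y\<close> to
    \<open>x\<close>: jump by \<open>k\<close> steps for the price \<open>u k\<close>, then pay the
    remaining distance.\<close>
  define h where "h x y k = mdist A x (?\<sigma> k y) + u k" for x y k
  define D where "D x y = (INF k. h x y k)" for x y
  have h_nonneg: "0 \<le> h x y k" for x y k using u_nonneg by (simp add: h_def)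
  have bdd: "bdd_below (range (h x y))" for x y
    by (rule bdd_belowI[of _ 0]) (use h_nonneg in auto)
  have D_le: "D x y \<le> h x y k" for x y k unfolding D_def by (rule cINF_lower[OF bdd]) simp
  have le_D: "c \<le> D x y" if "\<And>k. c \<le> h x y k" for c x y
    unfolding D_def by (rule cINF_greatest) (use that in auto)
  have D_nonneg: "0 \<le> D x y" for x y using le_D h_nonneg .
  have D_less: "\<exists>k. h x y k < e" if "D x y < e" for x y e
    using that le_D[of e x y] by (meson linorder_not_less)
  have D_le_d: "D x y \<le> mdist A x y" for x y
    using D_le[of x y 0] u0 by (simp add: h_def)
  have D_sym_le: "D x y \<le> D y x" if "x \<in> mspace A" "y \<in> mspace A" for x y
  proof (rule le_D)
    fix k
    \<comment> \<open>Swapping the points reverses the time, at the same cost because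
      \<open>u\<close> is even.\<close>
    have "mdist A x (?\<sigma> (- k) y) = mdist A y (?\<sigma> k x)"
      using isoA'[of x "?\<sigma> (- k) y" k] that zA ziter_neg(2)[OF dA that(2), of k]
      by (simp add: mdist_commute)
    then show "D x y \<le> h y x k" using D_le[of x y "- k"] u_neg by (simp add: h_def)
  qed
  have D_tri: "D x z \<le> D x y + D y z"
    if xyz: "x \<in> mspace A" "y \<in> mspace A" "z \<in> mspace A" for x y z
  proof -
    have "D x z \<le> h x y k + h y z l" for k l
    proof -
      have "mdist A x (?\<sigma> (k + l) z) \<le> mdist A x (?\<sigma> k y) + mdist A (?\<sigma> k y) (?\<sigma> (k + l) z)"
        using triA zA xyz by simp
      also have "mdist A (?\<sigma> k y) (?\<sigma> (k + l) z) = mdist A y (?\<sigma> l z)"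
        using isoA'[of y "?\<sigma> l z" k] xyz zA ziter_add[OF dA xyz(3)] by simp
      finally show ?thesis using u_add[of k l] D_le[of x z "k + l"] by (simp add: h_def)
    qed
    \<comment> \<open>The bound holds for all \<open>k\<close> and \<open>l\<close>, so the two
      infima are taken one after the other, the one over \<open>l\<close> first.\<close>
    then have "D x z - h x y k \<le> D y z" for k by (intro le_D) (simp add: diff_le_eq add.commute)
    then have "D x z - D y z \<le> D x y" by (intro le_D) (simp add: diff_le_eq add.commute)
    then show ?thesis by simp
  qed
  have D_inv: "D (s x) (s y) = D x y" if "x \<in> mspace A" "y \<in> mspace A" for x y
  proof -
    have "?\<sigma> k (s y) = s (?\<sigma> k y)" for k
      using ziter_add_1[OF dA that(2), of k] ziter_add[OF dA that(2), of k 1]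
        ziter_add_1[OF dA that(2), of 0] by simp
    then have "h (s x) (s y) = h x y" using that isoA zA by (simp add: h_def fun_eq_iff)
    then show ?thesis by (simp add: D_def)
  qed
  have "\<exists>(W :: 'a set metric) Q f. equicontinuous_system W Q \<and> factor_map A s W Q f \<and>
    (\<forall>x\<in>mspace A. \<forall>y\<in>mspace A. mdist W (f x) (f y) = D x y)"
  proof (rule pseudometric_quotient_system[OF dA])
    show "D x x = 0" if "x \<in> mspace A" for x
      using that D_le_d[of x x] D_nonneg[of x x] mdist_self[of x A] by simp
    show "D x y = D y x" if "x \<in> mspace A" "y \<in> mspace A" for x y
      using that D_sym_le by (meson order_antisym)
    show "\<exists>d>0. \<forall>y\<in>mspace A. mdist A x y < d \<longrightarrow> D x y < e" if "0 < e" for x and e :: real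
      using that D_le_d order_le_less_trans by blast
  qed (fact D_tri D_inv)+
  then obtain W :: "'a set metric" and Q f where W: "equicontinuous_system W Q"
    and f: "factor_map A s W Q f"
    and Df: "\<And>x y. x \<in> mspace A \<Longrightarrow> y \<in> mspace A \<Longrightarrow> mdist W (f x) (f y) = D x y"
    by blast
  have fW: "f x \<in> mspace W" if "x \<in> mspace A" for x using f that by (auto simp: factor_map_def)
  have f_eq: "f x = f y \<longleftrightarrow> D x y = 0" if "x \<in> mspace A" "y \<in> mspace A" for x y
    using that Df[of x y] fW mdist_zero[of "f x" W "f y"] by simp

  have dAB: "dyn_system (prod_metric A B) (map_prod s t)" using dA dB by (rule dyn_system_prod)
  have ab0: "(a\<^sub>0, b\<^sub>0) \<in> mspace (prod_metric A B)" using a0 b0 by simp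
  have E_inv: "closed_invariant (prod_metric A B) (map_prod s t) E"
    unfolding E_def using dAB ab0 by (rule orbit_closure_closed_invariant)
  have E_ne: "E \<noteq> {}" unfolding E_def using orbit_closure_self[OF dAB ab0] by blast
  have E_sub: "a \<in> mspace A \<and> b \<in> mspace B" if "(a, b) \<in> E" for a b
    using closed_invariant_subset[OF E_inv] that by auto
  have E_iff: "(a, b) \<in> E \<longleftrightarrow> (\<forall>e>0. \<exists>n. mdist A a (?\<sigma> n a\<^sub>0) < e \<and> mdist B b (?\<tau> n b\<^sub>0) < e)"
    if "a \<in> mspace A" "b \<in> mspace B" for a b
    unfolding E_def using in_closure_of_zorbit_prod[OF dA dB a0 b0 that] .
  \<comment> \<open>If the times \<open>n\<close> and \<open>m\<close> approximate the two pairs,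
    then \<open>n - m\<close> carries \<open>a'\<close> near \<open>a\<close> and moves
    \<open>b\<^sub>0\<close> by about the distance from \<open>b\<close> to \<open>b'\<close>. Hence
    all points paired with one \<open>b\<close> lie in one class, and the map \<open>g\<close> below
    is 1-Lipschitz.\<close>
  have E_D: "D a a' \<le> mdist B b b'" if E: "(a, b) \<in> E" "(a', b') \<in> E" for a b a' b'
  proof (rule field_le_epsilon)
    fix e :: real assume "0 < e"
    then have e: "0 < e / 4" by simp
    have ab: "a \<in> mspace A" "a' \<in> mspace A" "b \<in> mspace B" "b' \<in> mspace B" using E E_sub by auto
    obtain n where n: "mdist A a (?\<sigma> n a\<^sub>0) < e / 4" "mdist B b (?\<tau> n b\<^sub>0) < e / 4"
      using E(1) E_iff[of a b] ab e by blast
    obtain m where m: "mdist A a' (?\<sigma> m a\<^sub>0) < e / 4" "mdist B b' (?\<tau> m b\<^sub>0) < e / 4"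
      using E(2) E_iff[of a' b'] ab e by blast
    have "mdist A a (?\<sigma> (n - m) a') \<le> mdist A a (?\<sigma> n a\<^sub>0) + mdist A (?\<sigma> n a\<^sub>0) (?\<sigma> (n - m) a')"
      using triA zA ab a0 by simp
    also have "mdist A (?\<sigma> n a\<^sub>0) (?\<sigma> (n - m) a') = mdist A a' (?\<sigma> m a\<^sub>0)"
      using isoA'[of "?\<sigma> m a\<^sub>0" a' "n - m"] ziter_add[OF dA a0, of "n - m" m] zA a0 ab
      by (simp add: mdist_commute)
    finally have "mdist A a (?\<sigma> (n - m) a') < e / 2" using n m by simp
    moreover have "u (n - m) = mdist B (?\<tau> m b\<^sub>0) (?\<tau> n b\<^sub>0)" by (simp add: u_diff)
    moreover have "\<dots> \<le> mdist B b' (?\<tau> m b\<^sub>0) + (mdist B b b' + mdist B b (?\<tau> n b\<^sub>0))"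
      using triB[of "?\<tau> m b\<^sub>0" b' "?\<tau> n b\<^sub>0"] triB[of b' b "?\<tau> n b\<^sub>0"] zB b0 ab
      by (simp add: mdist_commute)
    ultimately show "D a a' \<le> mdist B b b' + e"
      using D_le[of a a' "n - m"] n(2) m(2) unfolding h_def by argo
  qed
  \<comment> \<open>Conversely, over each \<open>b\<close> the set \<open>E\<close> is a union of
    classes: a time \<open>k\<close> that carries \<open>a'\<close> near \<open>a\<close> at small
    cost barely moves \<open>b\<^sub>0\<close>, so \<open>k + n\<close> serves \<open>(a, b)\<close>
    if \<open>n\<close> serves \<open>(a', b)\<close>.\<close>
  have D_E: "(a, b) \<in> E" if D: "D a a' = 0" and E: "(a', b) \<in> E" and a: "a \<in> mspace A" for a a' b
  proof -
    have ab: "a' \<in> mspace A" "b \<in> mspace B" using E E_sub by auto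
    show ?thesis
      unfolding E_iff[OF a ab(2)]
    proof (intro allI impI)
      fix e :: real assume "0 < e"
      then have e: "0 < e / 2" by simp
      obtain k where k: "h a a' k < e / 2" using D_less[of a a' "e / 2"] D e by auto
      obtain n where n: "mdist A a' (?\<sigma> n a\<^sub>0) < e / 2" "mdist B b (?\<tau> n b\<^sub>0) < e / 2"
        using E E_iff[OF ab] e by blast
      have "mdist A a (?\<sigma> (k + n) a\<^sub>0) \<le> mdist A a (?\<sigma> k a') + mdist A (?\<sigma> k a') (?\<sigma> (k + n) a\<^sub>0)"
        using triA zA ab a a0 by simp
      also have "mdist A (?\<sigma> k a') (?\<sigma> (k + n) a\<^sub>0) = mdist A a' (?\<sigma> n a\<^sub>0)"
        using isoA'[of a' "?\<sigma> n a\<^sub>0" k] ziter_add[OF dA a0, of k n] zA a0 ab by simp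
      finally have "mdist A a (?\<sigma> (k + n) a\<^sub>0) < e"
        using n k u_nonneg[of k] by (simp add: h_def)
      moreover have "mdist B b (?\<tau> (k + n) b\<^sub>0) \<le> mdist B b (?\<tau> n b\<^sub>0) + u k"
        using triB[of b "?\<tau> n b\<^sub>0" "?\<tau> (k + n) b\<^sub>0"] zB b0 ab u_diff[of n "k + n"] by simp
      then have "mdist B b (?\<tau> (k + n) b\<^sub>0) < e"
        using n k mdist_nonneg[of A a "?\<sigma> k a'"] unfolding h_def by linarith
      ultimately show "\<exists>n. mdist A a (?\<sigma> n a\<^sub>0) < e \<and> mdist B b (?\<tau> n b\<^sub>0) < e" by blast
    qed
  qed

  have "\<exists>a. (a, b) \<in> E" if "b \<in> mspace B" for b
    using snd_closed_invariant[OF dA B E_inv E_ne] that by force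
  then obtain l where l: "\<And>b. b \<in> mspace B \<Longrightarrow> (l b, b) \<in> E" by metis
  have lA: "l b \<in> mspace A" if "b \<in> mspace B" for b using l E_sub that by blast
  \<comment> \<open>The class does not depend on the choice of \<open>l b\<close>, by
    \<open>E_D\<close> with equal second components.\<close>
  define g where "g b = f (l b)" for b
  have fg: "f a = g b \<longleftrightarrow> (a, b) \<in> E" if "a \<in> mspace A" "b \<in> mspace B" for a b
  proof
    assume "f a = g b"
    then show "(a, b) \<in> E" using that D_E l lA f_eq by (simp add: g_def)
  next
    assume "(a, b) \<in> E"
    then have "D a (l b) \<le> 0"
      using E_D[of a b "l b" b] l that mdist_self[of b B] by simp
    then show "f a = g b" using that D_nonneg[of a "l b"] lA f_eq by (simp add: g_def)
  qed
  have "factor_map B t W Q g"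
    unfolding factor_map_def
  proof (intro conjI ballI)
    have "mdist W (g b) (g b') \<le> mdist B b b'" if "b \<in> mspace B" "b' \<in> mspace B" for b b'
      using that E_D[of "l b" b "l b'" b'] l by (simp add: g_def Df lA)
    then show "continuous_map (mtopology_of B) (mtopology_of W) g"
      unfolding continuous_map_mtopology_of_iff
      using fW lA by (auto simp: g_def intro: order_le_less_trans)
    have fA: "f ` mspace A = mspace W" using f by (simp add: factor_map_def)
    show "g ` mspace B = mspace W"
    proof
      show "g ` mspace B \<subseteq> mspace W" using fW lA by (auto simp: g_def)
      show "mspace W \<subseteq> g ` mspace B"
        unfolding fA[symmetric]
      proof (rule image_subsetI)
        fix a assume a: "a \<in> mspace A"
        then have "a \<in> fst ` E" using fst_closed_invariant[OF A dB E_inv E_ne] by simp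
        then obtain b where "(a, b) \<in> E" by auto
        then show "f a \<in> g ` mspace B" using fg[OF a, of b] E_sub[of a b] by auto
      qed
    qed
    fix b assume b: "b \<in> mspace B"
    have "(s (l b), t b) \<in> E"
      using E_inv l[OF b] unfolding closed_invariant_def by (metis image_eqI map_prod_simp)
    then have "f (s (l b)) = g (t b)" using fg E_sub by blast
    then show "g (t b) = Q (g b)" using f lA[OF b] by (simp add: factor_map_def g_def)
  qed
  then show ?thesis using W f fg by blast
qed

lemma ziter_cong_mspace: "mspace A = mspace A' \<Longrightarrow> ziter A s = ziter A' s"
  by (simp add: ziter_def fun_eq_iff)

text \<open>Passing to invariant metrics changes neither carriers nor topologies, and orbits,
  minimality and factor maps depend on nothing else. This reduces the claim to the isometric
  case.\<close>

lemma orbit_closure_common_factor: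
  fixes A :: "'a metric" and B :: "'b metric"
  assumes A: "minimal_system A s" "equicontinuous_system A s"
    and B: "minimal_system B t" "equicontinuous_system B t"
    and ab: "a\<^sub>0 \<in> mspace A" "b\<^sub>0 \<in> mspace B"
  shows "\<exists>(W :: 'a set metric) Q f g. equicontinuous_system W Q \<and>
    factor_map A s W Q f \<and> factor_map B t W Q g \<and>
    (\<forall>a\<in>mspace A. \<forall>b\<in>mspace B. f a = g b \<longleftrightarrow>
       (a, b) \<in> mtopology_of (prod_metric A B) closure_of
                 zorbit (prod_metric A B) (map_prod s t) (a\<^sub>0, b\<^sub>0))"
proof -
  obtain A' :: "'a metric" where A': "mspace A' = mspace A" "mtopology_of A' = mtopology_of A"
    "\<And>x y. x \<in> mspace A' \<Longrightarrow> y \<in> mspace A' \<Longrightarrow> mdist A' (s x) (s y) = mdist A' x y"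
    using equicontinuous_invariant_metric[OF A(2)] by metis
  obtain B' :: "'b metric" where B': "mspace B' = mspace B" "mtopology_of B' = mtopology_of B"
    "\<And>x y. x \<in> mspace B' \<Longrightarrow> y \<in> mspace B' \<Longrightarrow> mdist B' (t x) (t y) = mdist B' x y"
    using equicontinuous_invariant_metric[OF B(2)] by metis
  have "minimal_system A' s" "minimal_system B' t"
    using A(1) B(1) A' B' ziter_cong_mspace[OF A'(1)] ziter_cong_mspace[OF B'(1)]
    by (simp_all add: minimal_system_def dyn_system_def zorbit_def)
  note * = isometric_orbit_closure_common_factor[OF this A'(3) B'(3), of a\<^sub>0 b\<^sub>0]
  have "ziter (prod_metric A' B') (map_prod s t) = ziter (prod_metric A B) (map_prod s t)"
    by (rule ziter_cong_mspace) (simp add: A' B')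
  then show ?thesis using * ab by (simp add: A' B' factor_map_def zorbit_def)
qed

section \<open>Unique minimal subsets in the fibres of an invariant map\<close>

text \<open>Two compact sets at distance 0 share a point, and two minimal subsets with a common
  point both equal its orbit closure.\<close>

lemma unique_minimal_subsetI:
  assumes P: "dyn_system P U" and C: "closed_invariant P U C" "C \<noteq> {}"
    and close: "\<And>p q e. p \<in> C \<Longrightarrow> q \<in> C \<Longrightarrow> 0 < e \<Longrightarrow>
      \<exists>i j. mdist P (ziter P U i p) (ziter P U j q) < e"
  shows "has_unique_minimal_subset P U C"
proof -
  have "M = M'" if M: "minimal_subset P U M" "M \<subseteq> C" "minimal_subset P U M'" "M' \<subseteq> C" for M M'
  proof -
    have inv: "closed_invariant P U M" "closed_invariant P U M'" and ne: "M \<noteq> {}" "M' \<noteq> {}"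
      using M by (auto simp: minimal_subset_def)
    have sub: "M \<subseteq> mspace P" "M' \<subseteq> mspace P" using inv closed_invariant_subset by blast+
    let ?d = "\<lambda>(u, w). mdist P u w"
    have "compactin (mtopology_of P) M" "compactin (mtopology_of P) M'"
      using inv dyn_system_compact[OF P] by (auto simp: closed_invariant_def closedin_compact_space)
    then have "compactin (prod_topology (mtopology_of P) (mtopology_of P)) (M \<times> M')"
      by (simp add: compactin_Times)
    \<comment> \<open>The set of distances between the two minimal subsets is compact, hence closed
      in the reals; the closeness assumption puts 0 into its closure.\<close>
    then have "compactin euclidean (?d ` (M \<times> M'))"
      using continuous_map_metric by (rule image_compactin)
    then have "closed (?d ` (M \<times> M'))" by (simp add: compact_imp_closed)
    moreover have "\<exists>v\<in>?d ` (M \<times> M'). dist v 0 < e" if "e > 0" for e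
    proof -
      obtain p q where pq: "p \<in> M" "q \<in> M'" using ne by blast
      then obtain i j where ij: "mdist P (ziter P U i p) (ziter P U j q) < e"
        using close[of p q e] subsetD[OF M(2)] subsetD[OF M(4)] \<open>e > 0\<close> by blast
      have "ziter P U i p \<in> M" "ziter P U j q \<in> M'"
        using pq sub closed_invariant_ziter[OF P inv(1)] closed_invariant_ziter[OF P inv(2)] by auto
      then have "mdist P (ziter P U i p) (ziter P U j q) \<in> ?d ` (M \<times> M')"
        by (metis (mono_tags, lifting) SigmaI case_prod_conv image_eqI)
      moreover have "dist (mdist P (ziter P U i p) (ziter P U j q)) 0 < e" using ij by simp
      ultimately show ?thesis by blast
    qed
    ultimately have "0 \<in> ?d ` (M \<times> M')"
      using closed_approachable by blast
    then obtain u w where "u \<in> M" "w \<in> M'" "mdist P u w = 0" by auto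
    then have "u \<in> M" "u \<in> M'" using sub mdist_zero[of u P w] by auto
    then show "M = M'" using M(1,3) by (auto simp: minimal_subset_def)
  qed
  then show ?thesis
    using minimal_subset_exists[OF P C] unfolding has_unique_minimal_subset_def by blast
qed

lemma in_fibre_iff: "p \<in> fibre P \<gamma> z \<longleftrightarrow> p \<in> mspace P \<and> \<gamma> p = z"
  by (simp add: fibre_def)

lemma fibre_closed_invariant:
  assumes P: "dyn_system P U" and \<gamma>: "continuous_map (mtopology_of P) (mtopology_of Z) \<gamma>"
    and inv: "\<And>p. p \<in> mspace P \<Longrightarrow> \<gamma> (U p) = \<gamma> p" and z: "z \<in> mspace Z"
  shows "closed_invariant P U (fibre P \<gamma> z)"
proof -
  have "closedin (mtopology_of Z) {z}"
    using z by (simp add: closedin_Hausdorff_singleton Hausdorff_mtopology_of)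
  then show ?thesis
    using closedin_continuous_map_preimage[OF \<gamma>, of "{z}"] inv dyn_system_in[OF P]
    by (simp add: closed_invariant_iff[OF P] fibre_def)
qed

text \<open>The complement is the image under \<open>\<gamma>\<close> of a compact set: the pairs in
  a common fibre whose orbits stay at least \<open>e\<close> apart.\<close>

lemma openin_close_orbits:
  assumes P: "dyn_system P U" and \<gamma>: "continuous_map (mtopology_of P) (mtopology_of Z) \<gamma>"
  shows "openin (mtopology_of Z) {z \<in> mspace Z. \<forall>p\<in>fibre P \<gamma> z. \<forall>q\<in>fibre P \<gamma> z.
           \<exists>i j. mdist P (ziter P U i p) (ziter P U j q) < e}" (is "openin _ ?V")
proof -
  let ?P = "mtopology_of P" and ?PP = "prod_topology (mtopology_of P) (mtopology_of P)"
  define K where "K = {w \<in> topspace ?PP. \<gamma> (fst w) = \<gamma> (snd w)} \<inter>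
     (\<Inter>(i, j)\<in>UNIV. {w \<in> topspace ?PP.
        mdist P (ziter P U i (fst w)) (ziter P U j (snd w)) \<in> {e..}})"
  have "closedin ?PP K"
    unfolding K_def
  proof (intro closedin_Int closedin_INT)
    show "closedin ?PP {w \<in> topspace ?PP. \<gamma> (fst w) = \<gamma> (snd w)}"
      using continuous_map_compose[OF continuous_map_fst[of ?P ?P] \<gamma>]
        continuous_map_compose[OF continuous_map_snd[of ?P ?P] \<gamma>]
      by (intro closedin_continuous_maps_eq[OF Hausdorff_mtopology_of]) (simp_all add: o_def)
    fix ij :: "int \<times> int"
    obtain i j where ij: "ij = (i, j)" by fastforce
    have "continuous_map ?PP euclidean
        (\<lambda>w. mdist P (ziter P U i (fst w)) (ziter P U j (snd w)))"
      using continuous_map_compose[OF continuous_map_fst[of ?P ?P] continuous_map_ziter[OF P]]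
        continuous_map_compose[OF continuous_map_snd[of ?P ?P] continuous_map_ziter[OF P]]
      by (intro continuous_map_mdist) (simp_all add: o_def)
    from closedin_continuous_map_preimage[OF this, of "{e..}"]
    show "closedin ?PP (case ij of (i, j) \<Rightarrow> {w \<in> topspace ?PP.
        mdist P (ziter P U i (fst w)) (ziter P U j (snd w)) \<in> {e..}})"
      by (simp add: ij)
  qed auto
  then have "compactin ?PP K"
    using dyn_system_compact[OF P] by (simp add: closedin_compact_space compact_space_prod_topology)
  then have "compactin (mtopology_of Z) ((\<gamma> \<circ> fst) ` K)"
    by (rule image_compactin) (rule continuous_map_compose[OF continuous_map_fst \<gamma>])
  then have "closedin (mtopology_of Z) ((\<gamma> \<circ> fst) ` K)"
    by (rule compactin_imp_closedin[OF Hausdorff_mtopology_of])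
  moreover have "?V = mspace Z - (\<gamma> \<circ> fst) ` K"
  proof -
    have K_iff: "z \<in> (\<gamma> \<circ> fst) ` K \<longleftrightarrow>
      (\<exists>p\<in>fibre P \<gamma> z. \<exists>q\<in>fibre P \<gamma> z. \<forall>i j. e \<le> mdist P (ziter P U i p) (ziter P U j q))" for z
    proof
      show "\<exists>p\<in>fibre P \<gamma> z. \<exists>q\<in>fibre P \<gamma> z. \<forall>i j. e \<le> mdist P (ziter P U i p) (ziter P U j q)"
        if zK: "z \<in> (\<gamma> \<circ> fst) ` K"
      proof -
        obtain p q where "(p, q) \<in> K" "z = \<gamma> p" using zK by auto
        then show ?thesis by (intro bexI[of _ p] bexI[of _ q]) (simp_all add: K_def in_fibre_iff)
      qed
      assume "\<exists>p\<in>fibre P \<gamma> z. \<exists>q\<in>fibre P \<gamma> z. \<forall>i j. e \<le> mdist P (ziter P U i p) (ziter P U j q)"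
      then obtain p q where "p \<in> mspace P" "q \<in> mspace P" "\<gamma> p = z" "\<gamma> q = z"
        "\<And>i j. e \<le> mdist P (ziter P U i p) (ziter P U j q)" by (auto simp: in_fibre_iff)
      then show "z \<in> (\<gamma> \<circ> fst) ` K"
        by (intro image_eqI[of _ _ "(p, q)"]) (auto simp: K_def)
    qed
    show ?thesis
      unfolding set_eq_iff Diff_iff mem_Collect_eq K_iff by (simp add: linorder_not_le)
  qed
  ultimately show ?thesis using openin_diff[OF openin_topspace] by fastforce
qed

text \<open>In the next two lemmas \<open>V\<close> permutes the fibres of \<open>\<gamma>\<close> the way \<open>R\<close> moves their base points;
  below it is \<open>T \<times> id\<close>.\<close>

lemma residual_unique_minimal_subset:
  assumes P: "dyn_system P U" and V: "dyn_system P V" and Z: "minimal_system Z R"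
    and \<gamma>: "continuous_map (mtopology_of P) (mtopology_of Z) \<gamma>" "\<gamma> ` mspace P = mspace Z"
    and \<gamma>U: "\<And>p. p \<in> mspace P \<Longrightarrow> \<gamma> (U p) = \<gamma> p"
    and \<gamma>V: "\<And>p. p \<in> mspace P \<Longrightarrow> \<gamma> (V p) = R (\<gamma> p)"
    and UV: "\<And>p. p \<in> mspace P \<Longrightarrow> U (V p) = V (U p)"
    and full: "\<And>J. closed_invariant P U J \<Longrightarrow> \<gamma> ` J = mspace Z \<Longrightarrow> J = mspace P"
  shows "\<exists>\<Omega>. gdelta_in (mtopology_of Z) \<Omega> \<and> mtopology_of Z closure_of \<Omega> = mspace Z \<and>
    (\<forall>z\<in>\<Omega>. has_unique_minimal_subset P U (fibre P \<gamma> z))"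
proof -
  have dZ: "dyn_system Z R" using Z by (rule minimal_system_dyn)
  let ?U = "ziter P U" and ?V = "ziter P V" and ?R = "ziter Z R"
  define G where "G e = {z \<in> mspace Z. \<forall>p\<in>fibre P \<gamma> z. \<forall>q\<in>fibre P \<gamma> z.
      \<exists>i j. mdist P (?U i p) (?U j q) < e}" for e
  have G_open: "openin (mtopology_of Z) (G e)" for e
    unfolding G_def by (rule openin_close_orbits[OF P \<gamma>(1)])
  note zU = ziter_in[OF P] and zV = ziter_in[OF V]
  have V_in: "V p \<in> mspace P" if "p \<in> mspace P" for p using dyn_system_in[OF V that] .
  have VU: "?V n (?U i p) = ?U i (?V n p)" if "p \<in> mspace P" for n i p
  proof -
    have "V (?U i p) = ?U i (V p)" if "p \<in> mspace P" for p
      by (rule ziter_equivariant[OF P P _ _ that]) (auto simp: V_in UV)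
    then show ?thesis
      by (intro ziter_equivariant[OF V V _ _ that, symmetric]) (auto simp: zU)
  qed
  have \<gamma>V': "\<gamma> (?V n p) = ?R n (\<gamma> p)" if "p \<in> mspace P" for n p
    using \<gamma> that by (intro ziter_equivariant[OF V dZ]) (auto simp: \<gamma>V)
  have G_dense: "mtopology_of Z closure_of (G e) = mspace Z" if e: "0 < e" for e
  proof (rule ccontr)
    assume "mtopology_of Z closure_of (G e) \<noteq> mspace Z"
    define O' where "O' = mspace Z - mtopology_of Z closure_of (G e)"
    have O_open: "openin (mtopology_of Z) O'"
      unfolding O'_def using openin_diff[OF openin_topspace closedin_closure_of, of "mtopology_of Z" "G e"]
      by simp
    have O_ne: "O' \<noteq> {}"
      using \<open>_ \<noteq> mspace Z\<close> closure_of_subset_topspace[of "mtopology_of Z" "G e"] by (auto simp: O'_def)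
    have O_G: "z \<notin> G e" if "z \<in> O'" for z
      using that closure_of_subset[of "G e" "mtopology_of Z"] by (auto simp: O'_def G_def)
    have hit: "\<exists>n. ?R n z \<in> O'" if z: "z \<in> mspace Z" for z
    proof -
      obtain w where "w \<in> O'" using O_ne by blast
      then have "w \<in> mtopology_of Z closure_of zorbit Z R z"
        using Z z by (auto simp: minimal_system_def O'_def)
      then show ?thesis using O_open \<open>w \<in> O'\<close> by (auto simp: in_closure_of zorbit_def)
    qed
    \<comment> \<open>By minimality every orbit visits the exterior \<open>O'\<close>; compactness
      bounds the visiting times by a finite set \<open>F\<close>.\<close>
    define H where "H n = {z \<in> topspace (mtopology_of Z). ?R n z \<in> O'}" for n
    have "openin (mtopology_of Z) (H n)" for n
      unfolding H_def using continuous_map_ziter[OF dZ] O_open by (rule openin_continuous_map_preimage)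
    moreover have "mspace Z \<subseteq> \<Union>(range H)" using hit by (auto simp: H_def)
    moreover have "compactin (mtopology_of Z) (mspace Z)"
      using dyn_system_compact[OF dZ] by (simp add: compact_space_def)
    ultimately have "\<exists>\<F>. finite \<F> \<and> \<F> \<subseteq> range H \<and> mspace Z \<subseteq> \<Union>\<F>"
      by (intro compactinD) auto
    then obtain \<F> where "finite \<F>" "\<F> \<subseteq> range H" "mspace Z \<subseteq> \<Union>\<F>" by blast
    then obtain F where F: "finite F" "mspace Z \<subseteq> (\<Union>n\<in>F. H n)"
      by (metis finite_subset_image)
    have "mspace Z \<noteq> {}" using O_ne by (auto simp: O'_def)
    then obtain v where v: "v \<in> mspace P" using \<gamma>(2) by blast
    \<comment> \<open>A neighbourhood of \<open>v\<close> so small that at the finitely many times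
      in \<open>F\<close> the iterates under \<open>V\<close> stay within \<open>e / 2\<close> of
      those of \<open>v\<close>.\<close>
    define N where "N = (\<Inter>n\<in>F. {w \<in> topspace (mtopology_of P). mdist P (?V n v) (?V n w) \<in> {..<e / 2}})
        \<inter> topspace (mtopology_of P)"
    have "openin (mtopology_of P) N"
      unfolding N_def
    proof (rule openin_INT[OF F(1)])
      fix n
      have "continuous_map (mtopology_of P) euclidean (\<lambda>w. mdist P (?V n v) (?V n w))"
        by (intro continuous_map_mdist continuous_map_ziter[OF V]) (simp add: zV[OF v])
      then show "openin (mtopology_of P)
          {w \<in> topspace (mtopology_of P). mdist P (?V n v) (?V n w) \<in> {..<e / 2}}"
        by (rule openin_continuous_map_preimage) simp
    qed
    then have N_pre: "openin (mtopology_of P) {p \<in> topspace (mtopology_of P). ?U i p \<in> N}" for i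
      by (intro openin_continuous_map_preimage[OF continuous_map_ziter[OF P]])
    \<comment> \<open>This set misses \<open>v\<close>, so once it is shown to meet every fibre of
      \<open>\<gamma>\<close>, the assumption \<open>full\<close> is contradicted.\<close>
    define J where "J = {p \<in> mspace P. \<forall>i. ?U i p \<notin> N}"
    have J_eq: "J = mspace P - (\<Union>i. {p \<in> topspace (mtopology_of P). ?U i p \<in> N})"
      by (auto simp: J_def)
    have "openin (mtopology_of P) (\<Union>i. {p \<in> topspace (mtopology_of P). ?U i p \<in> N})"
      using N_pre by (intro openin_Union) blast
    from closedin_diff[OF closedin_topspace this]
    have "closedin (mtopology_of P) J" unfolding J_eq by simp
    moreover have "U p \<in> J \<longleftrightarrow> p \<in> J" if p: "p \<in> mspace P" for p
    proof -
      have "?U i (U p) = ?U (i + 1) p" for i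
        using ziter_add[OF P p, of i 1] ziter_add_1[OF P p, of 0] by simp
      moreover have "(\<forall>i. ?U (i + 1) p \<notin> N) \<longleftrightarrow> (\<forall>i. ?U i p \<notin> N)"
        by (metis diff_add_cancel)
      ultimately show ?thesis using p dyn_system_in[OF P p] by (simp add: J_def)
    qed
    ultimately have J: "closed_invariant P U J" by (simp add: closed_invariant_iff[OF P])
    have "z \<in> \<gamma> ` J" if z: "z \<in> mspace Z" for z
    proof -
      obtain n where n: "n \<in> F" "?R n z \<in> O'" using F z by (auto simp: H_def)
      then have "?R n z \<notin> G e" "?R n z \<in> mspace Z" using O_G ziter_in[OF dZ z] by auto
      \<comment> \<open>The orbits of \<open>p\<close> and \<open>q\<close> stay \<open>e\<close>
        apart, so they cannot both come within \<open>e / 2\<close> of \<open>?V n v\<close>. The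
        point whose orbit does not, moved back by \<open>?V (- n)\<close> into the fibre over
        \<open>z\<close>, lies in \<open>J\<close>.\<close>
      then obtain p q where pq: "p \<in> mspace P" "q \<in> mspace P" "\<gamma> p = ?R n z" "\<gamma> q = ?R n z"
        and far: "\<And>i j. e \<le> mdist P (?U i p) (?U j q)"
        by (auto simp: G_def in_fibre_iff not_less)
      have pullback: "\<gamma> (?V (- n) p) = z" if "p \<in> mspace P" "\<gamma> p = ?R n z" for p
        using that \<gamma>V' ziter_neg[OF dZ z] by simp
      have near: "\<exists>i. mdist P (?V n v) (?U i p) < e / 2"
        if p: "p \<in> mspace P" and pJ: "?V (- n) p \<notin> J" for p
      proof -
        obtain i where "?U i (?V (- n) p) \<in> N" using pJ zV[OF p] by (auto simp: J_def)
        then have "mdist P (?V n v) (?V n (?U i (?V (- n) p))) < e / 2" using n by (auto simp: N_def)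
        moreover have "?V n (?U i (?V (- n) p)) = ?U i p"
          using VU zV p ziter_neg[OF V p] by simp
        ultimately show ?thesis by auto
      qed
      have "?V (- n) p \<in> J \<or> ?V (- n) q \<in> J"
      proof (rule ccontr)
        assume "\<not> ?thesis"
        then obtain i j where "mdist P (?V n v) (?U i p) < e / 2" "mdist P (?V n v) (?U j q) < e / 2"
          using near pq by meson
        moreover have "mdist P (?U i p) (?U j q) \<le> mdist P (?V n v) (?U i p) + mdist P (?V n v) (?U j q)"
          using mdist_triangle[of "?U i p" P "?V n v" "?U j q"] zU zV pq v by (simp add: mdist_commute)
        ultimately show False using far[of i j] by simp
      qed
      then show ?thesis using pullback pq by blast
    qed
    moreover have "\<gamma> ` J \<subseteq> mspace Z" using \<gamma>(2) by (auto simp: J_def)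
    ultimately have "J = mspace P" using full[OF J] by blast
    moreover have "v \<in> N" using v e zV by (simp add: N_def mdist_self)
    ultimately show False using v unfolding J_def by (metis (mono_tags, lifting) mem_Collect_eq ziter_0)
  qed
  \<comment> \<open>Membership in all these sets makes any two orbits in the fibre come arbitrarily
    close, which is the criterion of \<open>unique_minimal_subsetI\<close>.\<close>
  define \<Omega> where "\<Omega> = (\<Inter>k. G (1 / real (Suc k)))"
  have "gdelta_in (mtopology_of Z) \<Omega>"
    unfolding \<Omega>_def by (intro gdelta_in_Inter) (auto intro: open_imp_gdelta_in G_open)
  moreover have "mtopology_of Z closure_of \<Omega> = mspace Z"
  proof -
    have "locally_compact_space (mtopology_of Z)" "regular_space (mtopology_of Z)"
      using dyn_system_compact[OF dZ] Hausdorff_mtopology_of[of Z]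
        compact_Hausdorff_imp_regular_space[of "mtopology_of Z"]
      by (auto simp: compact_imp_locally_compact_space)
    then have "mtopology_of Z closure_of \<Omega> = topspace (mtopology_of Z)"
      unfolding \<Omega>_def by (intro Baire_category) (auto simp: G_open G_dense)
    then show ?thesis by simp
  qed
  moreover have "has_unique_minimal_subset P U (fibre P \<gamma> z)" if z: "z \<in> \<Omega>" for z
  proof (rule unique_minimal_subsetI[OF P])
    have z': "z \<in> mspace Z" using z by (auto simp: \<Omega>_def G_def)
    show "closed_invariant P U (fibre P \<gamma> z)"
      by (rule fibre_closed_invariant[OF P \<gamma>(1) \<gamma>U z'])
    from z' have "z \<in> \<gamma> ` mspace P" using \<gamma>(2) by simp
    then show "fibre P \<gamma> z \<noteq> {}" by (auto simp: fibre_def)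
    fix p q and e :: real assume pq: "p \<in> fibre P \<gamma> z" "q \<in> fibre P \<gamma> z" and "0 < e"
    then obtain k where "1 / real (Suc k) < e" using nat_approx_posE by blast
    moreover have "z \<in> G (1 / real (Suc k))" using z by (auto simp: \<Omega>_def)
    ultimately show "\<exists>i j. mdist P (?U i p) (?U j q) < e"
      using pq unfolding G_def by (smt (verit, best) mem_Collect_eq)
  qed
  ultimately show ?thesis by blast
qed

lemma unique_minimal_subset_translates:
  assumes P: "dyn_system P U" and V: "dyn_system P V" and Z: "dyn_system Z R"
    and \<gamma>: "continuous_map (mtopology_of P) (mtopology_of Z) \<gamma>"
    and \<gamma>U: "\<And>p. p \<in> mspace P \<Longrightarrow> \<gamma> (U p) = \<gamma> p"
    and \<gamma>V: "\<And>p. p \<in> mspace P \<Longrightarrow> \<gamma> (V p) = R (\<gamma> p)"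
    and UV: "\<And>p. p \<in> mspace P \<Longrightarrow> U (V p) = V (U p)"
    and J: "closed_invariant P U J" "\<gamma> ` J = mspace Z"
    and z: "z \<in> mspace Z" "has_unique_minimal_subset P U (fibre P \<gamma> z)"
  shows "\<exists>p\<in>mspace P. \<forall>n. ziter P V n p \<in> J"
proof -
  obtain M where M: "minimal_subset P U M" "M \<subseteq> fibre P \<gamma> z"
    and uniq: "\<And>M'. minimal_subset P U M' \<Longrightarrow> M' \<subseteq> fibre P \<gamma> z \<Longrightarrow> M' = M"
    using z(2) unfolding has_unique_minimal_subset_def by blast
  obtain p where p: "p \<in> M" using M(1) by (auto simp: minimal_subset_def)
  have "ziter P V n p \<in> J" for n
  proof -
    \<comment> \<open>The part of the fibre over \<open>z\<close> that \<open>V\<close> carries into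
      \<open>J\<close> at time \<open>n\<close>. It is nonempty because \<open>J\<close> meets the
      fibre over \<open>ziter Z R n z\<close>, so it contains a minimal subset, which can only be
      \<open>M\<close>.\<close>
    let ?J = "{q \<in> mspace P. ziter P V n q \<in> J} \<inter> fibre P \<gamma> z"
    have "ziter P V n (U q) = U (ziter P V n q)" if "q \<in> mspace P" for q
      by (rule ziter_equivariant[OF V V _ _ that, symmetric]) (auto simp: UV dyn_system_in[OF P])
    then have inv: "closed_invariant P U ?J"
      using closed_invariant_preimage[OF P P J(1) continuous_map_ziter[OF V]]
        fibre_closed_invariant[OF P \<gamma> \<gamma>U z(1)]
      by (intro closed_invariant_Int[OF P]) auto
    have "ziter Z R n z \<in> \<gamma> ` J" using J(2) ziter_in[OF Z z(1)] by simp
    then obtain q where q: "q \<in> J" "q \<in> mspace P" "\<gamma> q = ziter Z R n z"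
      using closed_invariant_subset[OF J(1)] by fastforce
    have "\<gamma> (ziter P V (- n) q) = ziter Z R (- n) (\<gamma> q)"
      using \<gamma> q(2) by (intro ziter_equivariant[OF V Z]) (auto simp: \<gamma>V continuous_map_def)
    then have "ziter P V (- n) q \<in> ?J"
      using q ziter_in[OF V q(2)] ziter_neg[OF V q(2)] ziter_neg[OF Z z(1)] by (simp add: in_fibre_iff)
    then obtain M' where "M' \<subseteq> ?J" "minimal_subset P U M'"
      using minimal_subset_exists[OF P inv] by blast
    then have "M \<subseteq> ?J" using uniq[of M'] by blast
    then show ?thesis using p by blast
  qed
  then show ?thesis using p M(2) by (intro bexI[of _ p]) (auto simp: fibre_def)
qed

section \<open>Quasi-disjointness\<close>

text \<open>\<open>R\<close> multiplies by a fixed element, which moves out of a product by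
  commutativity and cancels from a quotient. Hence \<open>\<gamma>\<close> is invariant under
  \<open>T \<times> S\<close>, while \<open>T \<times> id\<close> moves it by
  \<open>R\<close>.\<close>

lemma group_rotation_translate:
  assumes Z: "group_rotation Z R G" and xy: "x \<in> mspace Z" "y \<in> mspace Z"
  shows "R x \<otimes>\<^bsub>G\<^esub> y = R (x \<otimes>\<^bsub>G\<^esub> y)" "x \<otimes>\<^bsub>G\<^esub> R y = R (x \<otimes>\<^bsub>G\<^esub> y)"
    "R x \<otimes>\<^bsub>G\<^esub> inv\<^bsub>G\<^esub> (R y) = x \<otimes>\<^bsub>G\<^esub> inv\<^bsub>G\<^esub> y"
proof -
  interpret comm_group G using Z by (simp add: group_rotation_def)
  have G: "carrier G = mspace Z" using Z by (simp add: group_rotation_def)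
  obtain g where g: "g \<in> carrier G" "\<And>z. z \<in> carrier G \<Longrightarrow> R z = g \<otimes>\<^bsub>G\<^esub> z"
    using Z by (auto simp: group_rotation_def)
  have c: "x \<in> carrier G" "y \<in> carrier G" using xy G by auto
  show "R x \<otimes>\<^bsub>G\<^esub> y = R (x \<otimes>\<^bsub>G\<^esub> y)" "x \<otimes>\<^bsub>G\<^esub> R y = R (x \<otimes>\<^bsub>G\<^esub> y)"
    using c g by (simp_all add: m_assoc m_lcomm)
  have "g \<otimes>\<^bsub>G\<^esub> (inv\<^bsub>G\<^esub> g \<otimes>\<^bsub>G\<^esub> inv\<^bsub>G\<^esub> y) = inv\<^bsub>G\<^esub> y"
    using c g(1) by (simp flip: m_assoc)
  then show "R x \<otimes>\<^bsub>G\<^esub> inv\<^bsub>G\<^esub> (R y) = x \<otimes>\<^bsub>G\<^esub> inv\<^bsub>G\<^esub> y"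
    using c g(1) by (simp add: g(2) inv_mult m_comm[of g x] m_assoc)
qed

text \<open>The maximality of \<open>Z\<close> enters here: for the orbit closure \<open>E\<close> of a point of
  \<open>Xeq \<times> Yeq\<close>, the common factor that identifies \<open>a\<close> with \<open>b\<close> exactly when \<open>(a, b) \<in> E\<close> must
  factor through \<open>Z\<close>, so \<open>E\<close> is a whole fibre of the difference map.\<close>

lemma fibre_subset_orbit_closure:
  fixes Xeq :: "'c metric" and Yeq :: "'d metric"
  assumes X: "minimal_system X T" and Y: "minimal_system Y S"
    and eX: "equicontinuous_system Xeq Teq" and fX: "factor_map X T Xeq Teq \<pi>X"
    and eY: "equicontinuous_system Yeq Seq" and fY: "factor_map Y S Yeq Seq \<pi>Y"
    and mZ: "max_common_factor X T Y S Z R \<alpha> \<beta>"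
    and G: "group_rotation Z R G"
    and xy: "x \<in> mspace X" "y \<in> mspace Y" and xy': "x' \<in> mspace X" "y' \<in> mspace Y"
    and eq: "\<alpha> x \<otimes>\<^bsub>G\<^esub> inv\<^bsub>G\<^esub> (\<beta> y) = \<alpha> x' \<otimes>\<^bsub>G\<^esub> inv\<^bsub>G\<^esub> (\<beta> y')"
  shows "(\<pi>X x', \<pi>Y y') \<in> mtopology_of (prod_metric Xeq Yeq) closure_of
     zorbit (prod_metric Xeq Yeq) (map_prod Teq Seq) (\<pi>X x, \<pi>Y y)" (is "_ \<in> ?E")
proof -
  have dZ: "dyn_system Z R" and f\<alpha>: "factor_map X T Z R \<alpha>" and f\<beta>: "factor_map Y S Z R \<beta>"
    using mZ by (auto simp: max_common_factor_def equicontinuous_system_def)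
  have Z: "minimal_system Z R" using minimal_system_factor[OF X dZ f\<alpha>] .
  have "minimal_system Xeq Teq" "minimal_system Yeq Seq"
    using minimal_system_factor X Y fX fY eX eY by (auto simp: equicontinuous_system_def)
  moreover have \<pi>: "\<pi>X x \<in> mspace Xeq" "\<pi>Y y \<in> mspace Yeq" "\<pi>X x' \<in> mspace Xeq" "\<pi>Y y' \<in> mspace Yeq"
    using fX fY xy xy' by (auto simp: factor_map_def)
  ultimately obtain W :: "'c set metric" and Q f g where W: "equicontinuous_system W Q"
    and f: "factor_map Xeq Teq W Q f" and g: "factor_map Yeq Seq W Q g"
    and fg: "\<And>a b. a \<in> mspace Xeq \<Longrightarrow> b \<in> mspace Yeq \<Longrightarrow> f a = g b \<longleftrightarrow> (a, b) \<in> ?E"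
    using orbit_closure_common_factor[OF _ eX _ eY \<pi>(1,2)] by blast
  obtain \<eta>1 \<eta>2 where \<eta>: "factor_map Z R W Q \<eta>1" "factor_map Z R W Q \<eta>2"
    and \<eta>1: "\<And>x. x \<in> mspace X \<Longrightarrow> f (\<pi>X x) = \<eta>1 (\<alpha> x)"
    and \<eta>2: "\<And>y. y \<in> mspace Y \<Longrightarrow> g (\<pi>Y y) = \<eta>2 (\<beta> y)"
    using max_common_factorD[OF mZ W factor_map_compose[OF fX f] factor_map_compose[OF fY g]]
    by auto
  have dW: "dyn_system W Q" using W by (simp add: equicontinuous_system_def)
  interpret G: comm_group G using G by (simp add: group_rotation_def)
  have carr: "carrier G = mspace Z" using G by (simp add: group_rotation_def)
  have pts: "\<alpha> x \<in> carrier G" "\<beta> y \<in> carrier G" "\<alpha> x' \<in> carrier G" "\<beta> y' \<in> carrier G"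
    using f\<alpha> f\<beta> xy xy' by (auto simp: factor_map_def carr)
  \<comment> \<open>The common difference: translation by \<open>c\<close> takes
    \<open>\<beta> y\<close> to \<open>\<alpha> x\<close> and \<open>\<beta> y'\<close> to
    \<open>\<alpha> x'\<close>.\<close>
  define c where "c = \<alpha> x \<otimes>\<^bsub>G\<^esub> inv\<^bsub>G\<^esub> (\<beta> y)"
  have c: "c \<in> carrier G" using pts by (simp add: c_def)
  have c_x: "c \<otimes>\<^bsub>G\<^esub> \<beta> y = \<alpha> x" using pts by (simp add: c_def G.m_assoc)
  have c_x': "c \<otimes>\<^bsub>G\<^esub> \<beta> y' = \<alpha> x'" using pts by (simp add: c_def eq G.m_assoc)
  \<comment> \<open>The maps \<open>\<eta>1\<close> and \<open>\<eta>2\<close> may differ, but they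
    agree up to the translation by \<open>c\<close>: as this translation commutes with
    \<open>R\<close>, the set of agreement is closed and invariant, and it contains
    \<open>\<beta> y\<close>. By minimality it also contains \<open>\<beta> y'\<close>.\<close>
  define C where "C = {w \<in> topspace (mtopology_of Z). \<eta>1 (c \<otimes>\<^bsub>G\<^esub> w) = \<eta>2 w}"
  have mult: "continuous_map (mtopology_of Z) (mtopology_of Z) (\<lambda>w. c \<otimes>\<^bsub>G\<^esub> w)"
  proof -
    have "continuous_map (mtopology_of Z) (prod_topology (mtopology_of Z) (mtopology_of Z)) (\<lambda>w. (c, w))"
      using c by (simp add: continuous_map_pairedI carr)
    then show ?thesis
      using continuous_map_compose[of _ _ "\<lambda>w. (c, w)" _ "\<lambda>(x, y). x \<otimes>\<^bsub>G\<^esub> y"] G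
      by (fastforce simp: group_rotation_def o_def)
  qed
  have "closedin (mtopology_of Z) C"
    unfolding C_def
  proof (rule closedin_continuous_maps_eq[OF Hausdorff_mtopology_of])
    show "continuous_map (mtopology_of Z) (mtopology_of W) (\<lambda>w. \<eta>1 (c \<otimes>\<^bsub>G\<^esub> w))"
      using continuous_map_compose[OF mult] \<eta>(1) by (fastforce simp: factor_map_def o_def)
    show "continuous_map (mtopology_of Z) (mtopology_of W) \<eta>2"
      using \<eta>(2) by (simp add: factor_map_def)
  qed
  moreover have "R w \<in> C \<longleftrightarrow> w \<in> C" if w: "w \<in> mspace Z" for w
  proof -
    have cw: "c \<otimes>\<^bsub>G\<^esub> w \<in> mspace Z" using c w by (simp flip: carr)
    have "\<eta>1 (c \<otimes>\<^bsub>G\<^esub> R w) = Q (\<eta>1 (c \<otimes>\<^bsub>G\<^esub> w))"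
      using group_rotation_translate(2)[OF G _ w, of c] c cw \<eta>(1) by (simp add: carr factor_map_def)
    moreover have "\<eta>2 (R w) = Q (\<eta>2 w)" using \<eta>(2) w by (simp add: factor_map_def)
    moreover have "\<eta>1 (c \<otimes>\<^bsub>G\<^esub> w) \<in> mspace W" "\<eta>2 w \<in> mspace W"
      using \<eta> w cw by (auto simp: factor_map_def)
    ultimately have "\<eta>1 (c \<otimes>\<^bsub>G\<^esub> R w) = \<eta>2 (R w) \<longleftrightarrow> \<eta>1 (c \<otimes>\<^bsub>G\<^esub> w) = \<eta>2 w"
      using dyn_system_inj[OF dW] by metis
    then show ?thesis using w dyn_system_in[OF dZ w] by (simp add: C_def)
  qed
  ultimately have "closed_invariant Z R C" by (simp add: closed_invariant_iff[OF dZ])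
  moreover have "\<beta> y \<in> C"
  proof -
    have "(\<pi>X x, \<pi>Y y) \<in> ?E"
    proof (rule orbit_closure_self[OF dyn_system_prod])
      show "dyn_system Xeq Teq" "dyn_system Yeq Seq"
        using eX eY by (simp_all add: equicontinuous_system_def)
    qed (use \<pi> in simp)
    then have "f (\<pi>X x) = g (\<pi>Y y)" using fg[OF \<pi>(1,2)] by blast
    then show ?thesis using \<eta>1[OF xy(1)] \<eta>2[OF xy(2)] pts(2) by (simp add: C_def c_x carr)
  qed
  ultimately have "C = mspace Z" using minimal_system_closed_invariant[OF Z] by blast
  then have "\<beta> y' \<in> C" using pts by (simp add: carr)
  then have "f (\<pi>X x') = g (\<pi>Y y')"
    using \<eta>1[OF xy'(1)] \<eta>2[OF xy'(2)] by (simp add: C_def c_x')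
  then show ?thesis using fg[OF \<pi>(3,4)] by blast
qed

theorem theorem1p1:
  fixes X :: "'a metric" and T :: "'a \<Rightarrow> 'a"
    and Y :: "'b metric" and S :: "'b \<Rightarrow> 'b"
    and Xeq :: "'c metric" and Teq :: "'c \<Rightarrow> 'c" and \<pi>X :: "'a \<Rightarrow> 'c"
    and Yeq :: "'d metric" and Seq :: "'d \<Rightarrow> 'd" and \<pi>Y :: "'b \<Rightarrow> 'd"
    and Z :: "'e metric" and R :: "'e \<Rightarrow> 'e" and G :: "'e monoid"
    and \<alpha> :: "'a \<Rightarrow> 'e" and \<beta> :: "'b \<Rightarrow> 'e" and \<gamma> :: "'a \<times> 'b \<Rightarrow> 'e"
  assumes "minimal_system X T" and "minimal_system Y S"
    and "max_equicontinuous_factor X T Xeq Teq \<pi>X"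
    and "max_equicontinuous_factor Y S Yeq Seq \<pi>Y"
    and "max_common_factor X T Y S Z R \<alpha> \<beta>"
    and "group_rotation Z R G"
    and "\<gamma> = diff_map G \<alpha> \<beta>"
  shows "((\<exists>z\<in>mspace Z.
             has_unique_minimal_subset (prod_metric X Y) (map_prod T S)
               (fibre (prod_metric X Y) \<gamma> z))
          \<longleftrightarrow>
          (\<exists>\<Omega>. gdelta_in (mtopology_of Z) \<Omega> \<and> mtopology_of Z closure_of \<Omega> = mspace Z \<and>
             (\<forall>z\<in>\<Omega>. has_unique_minimal_subset (prod_metric X Y) (map_prod T S)
                       (fibre (prod_metric X Y) \<gamma> z))))
         \<and>
         ((\<exists>\<Omega>. gdelta_in (mtopology_of Z) \<Omega> \<and> mtopology_of Z closure_of \<Omega> = mspace Z \<and>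
             (\<forall>z\<in>\<Omega>. has_unique_minimal_subset (prod_metric X Y) (map_prod T S)
                       (fibre (prod_metric X Y) \<gamma> z)))
          \<longleftrightarrow>
          quasi_disjoint X T Xeq \<pi>X Y S Yeq \<pi>Y)"
proof -
  let ?P = "prod_metric X Y" and ?U = "map_prod T S" and ?V = "map_prod T id"
  let ?Q = "prod_metric Xeq Yeq" and ?UQ = "map_prod Teq Seq"
  note X = assms(1) and Y = assms(2) and mX = assms(3) and mY = assms(4) and mZ = assms(5)
    and rot = assms(6) and \<gamma>_def = assms(7)
  have dX: "dyn_system X T" and dY: "dyn_system Y S" using X Y by (auto simp: minimal_system_dyn)
  have fX: "factor_map X T Xeq Teq \<pi>X" and eX: "equicontinuous_system Xeq Teq"
    using mX by (auto simp: max_equicontinuous_factor_def)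
  have fY: "factor_map Y S Yeq Seq \<pi>Y" and eY: "equicontinuous_system Yeq Seq"
    using mY by (auto simp: max_equicontinuous_factor_def)
  have eZ: "equicontinuous_system Z R" and f\<alpha>: "factor_map X T Z R \<alpha>" and f\<beta>: "factor_map Y S Z R \<beta>"
    using mZ by (auto simp: max_common_factor_def)
  have dZ: "dyn_system Z R" using eZ by (simp add: equicontinuous_system_def)
  have Z: "minimal_system Z R" using minimal_system_factor[OF X dZ f\<alpha>] .
  have dXeq: "dyn_system Xeq Teq" and dYeq: "dyn_system Yeq Seq"
    using eX eY by (auto simp: equicontinuous_system_def)
  have dYid: "dyn_system Y id"
    using dyn_system_compact[OF dY] by (intro dyn_systemI) auto
  have dP: "dyn_system ?P ?U" and dV: "dyn_system ?P ?V" and dQ: "dyn_system ?Q ?UQ"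
    by (rule dyn_system_prod; fact)+
  interpret G: comm_group G using rot by (simp add: group_rotation_def)
  have carr: "carrier G = mspace Z" using rot by (simp add: group_rotation_def)
  have \<alpha>: "\<alpha> x \<in> mspace Z" "\<alpha> (T x) = R (\<alpha> x)" if "x \<in> mspace X" for x
    using f\<alpha> that by (auto simp: factor_map_def)
  have \<beta>: "\<beta> y \<in> mspace Z" "\<beta> (S y) = R (\<beta> y)" if "y \<in> mspace Y" for y
    using f\<beta> that by (auto simp: factor_map_def)
  have surj: "\<alpha> ` mspace X = mspace Z" "\<beta> ` mspace Y = mspace Z"
    using f\<alpha> f\<beta> by (simp_all add: factor_map_def)
  \<comment> \<open>\<open>minimal_system\<close> does not itself exclude an empty space; the unit
    of the group does.\<close>
  have Z_ne: "mspace Z \<noteq> {}" using G.one_closed carr by blast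
  then have XY_ne: "mspace X \<noteq> {}" "mspace Y \<noteq> {}" using surj by auto
  have \<gamma>: "\<gamma> (x, y) = \<alpha> x \<otimes>\<^bsub>G\<^esub> inv\<^bsub>G\<^esub> (\<beta> y)" for x y by (simp add: \<gamma>_def diff_map_def)
  have inv_in: "inv\<^bsub>G\<^esub> z \<in> mspace Z" if "z \<in> mspace Z" for z using that by (simp flip: carr)

  have \<gamma>_cont: "continuous_map (mtopology_of ?P) (mtopology_of Z) \<gamma>"
  proof -
    let ?Z = "mtopology_of Z" and ?XY = "prod_topology (mtopology_of X) (mtopology_of Y)"
    have "continuous_map ?XY ?Z (\<alpha> \<circ> fst)"
      using f\<alpha> by (intro continuous_map_compose[OF continuous_map_fst]) (simp add: factor_map_def)
    moreover have "continuous_map ?XY ?Z ((\<lambda>z. inv\<^bsub>G\<^esub> z) \<circ> (\<beta> \<circ> snd))"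
      using f\<beta> rot by (intro continuous_map_compose[OF continuous_map_compose[OF continuous_map_snd]])
        (auto simp: factor_map_def group_rotation_def)
    ultimately have "continuous_map ?XY (prod_topology ?Z ?Z) (\<lambda>p. (\<alpha> (fst p), inv\<^bsub>G\<^esub> (\<beta> (snd p))))"
      by (intro continuous_map_pairedI) (simp_all add: o_def)
    moreover have "continuous_map (prod_topology ?Z ?Z) ?Z (\<lambda>(x, y). x \<otimes>\<^bsub>G\<^esub> y)"
      using rot by (simp add: group_rotation_def)
    ultimately have "continuous_map ?XY ?Z
        ((\<lambda>(x, y). x \<otimes>\<^bsub>G\<^esub> y) \<circ> (\<lambda>p. (\<alpha> (fst p), inv\<^bsub>G\<^esub> (\<beta> (snd p)))))"
      by (rule continuous_map_compose)
    then show ?thesis by (simp add: \<gamma>_def diff_map_def o_def case_prod_unfold)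
  qed
  have \<gamma>_surj: "\<gamma> ` mspace ?P = mspace Z"
  proof
    show "\<gamma> ` mspace ?P \<subseteq> mspace Z"
      using \<alpha> \<beta> by (auto simp: \<gamma> simp flip: carr)
    show "mspace Z \<subseteq> \<gamma> ` mspace ?P"
    proof
      fix z assume z: "z \<in> mspace Z"
      \<comment> \<open>For one fixed \<open>y\<close>, surjectivity of \<open>\<alpha>\<close> lets
        the equation be solved for \<open>x\<close>.\<close>
      obtain y where y: "y \<in> mspace Y" using XY_ne by blast
      then have "z \<otimes>\<^bsub>G\<^esub> \<beta> y \<in> mspace Z" using z \<beta> by (simp flip: carr)
      then have "z \<otimes>\<^bsub>G\<^esub> \<beta> y \<in> \<alpha> ` mspace X" using surj by simp
      then obtain x where x: "x \<in> mspace X" "\<alpha> x = z \<otimes>\<^bsub>G\<^esub> \<beta> y" by force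
      have "z \<in> carrier G" "\<beta> y \<in> carrier G" using z y \<beta> by (simp_all add: carr)
      then have "\<gamma> (x, y) = z" using x(2) by (simp add: \<gamma> G.m_assoc)
      then show "z \<in> \<gamma> ` mspace ?P" using x y by force
    qed
  qed
  have \<gamma>U: "\<gamma> (?U p) = \<gamma> p" if "p \<in> mspace ?P" for p
    using that \<alpha> \<beta> group_rotation_translate(3)[OF rot] by (auto simp: \<gamma>)
  have \<gamma>V: "\<gamma> (?V p) = R (\<gamma> p)" if "p \<in> mspace ?P" for p
    using that \<alpha> \<beta> inv_in group_rotation_translate(1)[OF rot] by (auto simp: \<gamma>)
  have UV: "?U (?V p) = ?V (?U p)" for p by (cases p) simp

  \<comment> \<open>\<open>\<alpha>\<close> and \<open>\<beta>\<close> factor through the maximal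
    equicontinuous factors, so \<open>\<gamma>\<close> depends only on the images under
    \<open>\<pi>X\<close> and \<open>\<pi>Y\<close>.\<close>
  obtain \<alpha>' where \<alpha>': "\<And>x. x \<in> mspace X \<Longrightarrow> \<alpha> x = \<alpha>' (\<pi>X x)"
    using max_equicontinuous_factorD[OF mX eZ f\<alpha>] by blast
  obtain \<beta>' where \<beta>': "\<And>y. y \<in> mspace Y \<Longrightarrow> \<beta> y = \<beta>' (\<pi>Y y)"
    using max_equicontinuous_factorD[OF mY eZ f\<beta>] by blast
  have \<pi>_surj: "\<pi>X ` mspace X = mspace Xeq" "\<pi>Y ` mspace Y = mspace Yeq"
    using fX fY by (simp_all add: factor_map_def)
  have \<pi>_cont: "continuous_map (mtopology_of ?P) (mtopology_of ?Q) (map_prod \<pi>X \<pi>Y)"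
  proof -
    have "continuous_map (mtopology_of X) (mtopology_of Xeq) \<pi>X"
      "continuous_map (mtopology_of Y) (mtopology_of Yeq) \<pi>Y"
      using fX fY by (simp_all add: factor_map_def)
    from continuous_map_compose[OF continuous_map_fst[of _ "mtopology_of Y"] this(1)]
      continuous_map_compose[OF continuous_map_snd[of "mtopology_of X"] this(2)]
    show ?thesis by (simp add: map_prod_def case_prod_unfold continuous_map_pairedI o_def)
  qed

  \<comment> \<open>From left to right this is the factorization above. From right to left, the
    image of \<open>J\<close> is closed and invariant, so it contains the orbit closure of each of
    its points and, by \<open>fibre_subset_orbit_closure\<close>, the image of the whole fibre of
    \<open>\<gamma>\<close>.\<close>
  have onto_eq: "map_prod \<pi>X \<pi>Y ` J = mspace Xeq \<times> mspace Yeq \<longleftrightarrow> \<gamma> ` J = mspace Z"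
    if J: "closed_invariant ?P ?U J" for J
  proof
    have J_sub: "J \<subseteq> mspace X \<times> mspace Y" using closed_invariant_subset[OF J] by simp
    have \<gamma>J: "\<gamma> ` J \<subseteq> mspace Z" using J_sub \<gamma>_surj by auto
    assume full: "map_prod \<pi>X \<pi>Y ` J = mspace Xeq \<times> mspace Yeq"
    have "\<gamma> (x, y) \<in> \<gamma> ` J" if xy: "x \<in> mspace X" "y \<in> mspace Y" for x y
    proof -
      have "(\<pi>X x, \<pi>Y y) \<in> map_prod \<pi>X \<pi>Y ` J" unfolding full using \<pi>_surj xy by blast
      then obtain x' y' where "(x', y') \<in> J" "\<pi>X x' = \<pi>X x" "\<pi>Y y' = \<pi>Y y" by auto
      moreover from this have "\<gamma> (x', y') = \<gamma> (x, y)" using J_sub xy \<alpha>' \<beta>' by (auto simp: \<gamma>)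
      ultimately show ?thesis by (metis image_eqI)
    qed
    then have "\<gamma> ` mspace ?P \<subseteq> \<gamma> ` J" by auto
    then show "\<gamma> ` J = mspace Z" using \<gamma>J \<gamma>_surj by blast
  next
    assume full: "\<gamma> ` J = mspace Z"
    have J_sub: "J \<subseteq> mspace X \<times> mspace Y" using closed_invariant_subset[OF J] by simp
    have inv: "closed_invariant ?Q ?UQ (map_prod \<pi>X \<pi>Y ` J)"
      using fX fY by (intro closed_invariant_image[OF dP J \<pi>_cont]) (auto simp: factor_map_def)
    have "(\<pi>X x', \<pi>Y y') \<in> map_prod \<pi>X \<pi>Y ` J" if xy': "x' \<in> mspace X" "y' \<in> mspace Y" for x' y'
    proof -
      have "\<gamma> (x', y') \<in> \<gamma> ` J" unfolding full \<gamma>_surj[symmetric] using xy' by simp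
      then obtain x y where xy: "(x, y) \<in> J" "\<gamma> (x, y) = \<gamma> (x', y')" by force
      then have "(\<pi>X x', \<pi>Y y') \<in> mtopology_of ?Q closure_of zorbit ?Q ?UQ (\<pi>X x, \<pi>Y y)"
        using J_sub xy' by (intro fibre_subset_orbit_closure[OF X Y eX fX eY fY mZ rot]) (auto simp: \<gamma>)
      moreover have "(\<pi>X x, \<pi>Y y) \<in> map_prod \<pi>X \<pi>Y ` J" using xy(1) by force
      ultimately show ?thesis using subsetD[OF orbit_closure_subset[OF dQ inv]] by metis
    qed
    then have "mspace Xeq \<times> mspace Yeq \<subseteq> map_prod \<pi>X \<pi>Y ` J"
      unfolding \<pi>_surj[symmetric] by auto
    moreover have "map_prod \<pi>X \<pi>Y ` J \<subseteq> mspace Xeq \<times> mspace Yeq"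
      using J_sub \<pi>_surj by auto
    ultimately show "map_prod \<pi>X \<pi>Y ` J = mspace Xeq \<times> mspace Yeq" by blast
  qed
  \<comment> \<open>The projections of a nonempty closed invariant set are full by minimality of
    \<open>X\<close> and \<open>Y\<close>.\<close>
  have joining_iff: "joining X T Y S J \<longleftrightarrow> closed_invariant ?P ?U J" if "\<gamma> ` J = mspace Z" for J
  proof -
    have "J \<noteq> {}" using that Z_ne by auto
    then show ?thesis
      using fst_closed_invariant[OF X dY, of J] snd_closed_invariant[OF dX Y, of J]
      unfolding joining_def by blast
  qed
  have P_inv: "closed_invariant ?P ?U (mspace ?P)"
    unfolding closed_invariant_iff[OF dP]
    using closedin_topspace[of "mtopology_of ?P"] dyn_system_in[OF dP] by simp
  have qd: "quasi_disjoint X T Xeq \<pi>X Y S Yeq \<pi>Y \<longleftrightarrow>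
    (\<forall>J. closed_invariant ?P ?U J \<longrightarrow> \<gamma> ` J = mspace Z \<longrightarrow> J = mspace ?P)"
  proof -
    have "joining X T Y S J \<and> map_prod \<pi>X \<pi>Y ` J = mspace Xeq \<times> mspace Yeq
        \<longleftrightarrow> closed_invariant ?P ?U J \<and> \<gamma> ` J = mspace Z" for J
    proof -
      have "closed_invariant ?P ?U J" if "joining X T Y S J" using that by (simp add: joining_def)
      then show ?thesis using onto_eq[of J] joining_iff[of J] by argo
    qed
    then have "quasi_disjoint X T Xeq \<pi>X Y S Yeq \<pi>Y \<longleftrightarrow>
        {J. closed_invariant ?P ?U J \<and> \<gamma> ` J = mspace Z} = {mspace ?P}"
      by (simp add: quasi_disjoint_def)
    moreover have "{J. p J} = {A} \<longleftrightarrow> (\<forall>J. p J \<longrightarrow> J = A)" if "p A" for p and A :: "('a \<times> 'b) set"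
      using that by blast
    ultimately show ?thesis
      using P_inv \<gamma>_surj by (simp add: imp_conjL del: mspace_prod_metric)
  qed

  let ?unique = "\<lambda>z. has_unique_minimal_subset ?P ?U (fibre ?P \<gamma> z)"
  let ?generic = "\<exists>\<Omega>. gdelta_in (mtopology_of Z) \<Omega> \<and> mtopology_of Z closure_of \<Omega> = mspace Z \<and>
    (\<forall>z\<in>\<Omega>. ?unique z)"
  \<comment> \<open>The three implications form a cycle: a generic set has a point since
    \<open>Z\<close> is nonempty, quasi-disjointness gives a generic set, and one good point gives
    quasi-disjointness.\<close>
  have "\<exists>z\<in>mspace Z. ?unique z" if generic: ?generic
  proof -
    obtain \<Omega> where \<Omega>: "gdelta_in (mtopology_of Z) \<Omega>" "mtopology_of Z closure_of \<Omega> = mspace Z"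
      "\<forall>z\<in>\<Omega>. ?unique z" using generic by blast
    have "\<Omega> \<noteq> {}" using \<Omega>(2) Z_ne by auto
    then show ?thesis using \<Omega>(3) gdelta_in_subset[OF \<Omega>(1)] by auto
  qed
  moreover have ?generic if "quasi_disjoint X T Xeq \<pi>X Y S Yeq \<pi>Y"
    using that unfolding qd
    by (intro residual_unique_minimal_subset[OF dP dV Z \<gamma>_cont \<gamma>_surj \<gamma>U \<gamma>V UV]) auto
  moreover have "quasi_disjoint X T Xeq \<pi>X Y S Yeq \<pi>Y"
    if z: "z \<in> mspace Z" "?unique z" for z
    unfolding qd
  proof (intro allI impI)
    fix J assume J: "closed_invariant ?P ?U J" "\<gamma> ` J = mspace Z"
    have J_sub: "J \<subseteq> mspace X \<times> mspace Y" using closed_invariant_subset[OF J(1)] by simp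
    obtain x\<^sub>0 y\<^sub>0 where xy: "x\<^sub>0 \<in> mspace X" "y\<^sub>0 \<in> mspace Y"
      and in_J: "\<And>n. ziter ?P ?V n (x\<^sub>0, y\<^sub>0) \<in> J"
      using unique_minimal_subset_translates[OF dP dV dZ \<gamma>_cont \<gamma>U \<gamma>V UV J z] by auto
    \<comment> \<open>Iterating \<open>T \<times> id\<close> moves only the first coordinate, so
      \<open>J\<close> contains the orbit of \<open>x\<^sub>0\<close> at height
      \<open>y\<^sub>0\<close> and, being closed, all of
      \<open>mspace X \<times> {y\<^sub>0}\<close>.\<close>
    have "ziter ?P ?V n (x\<^sub>0, y\<^sub>0) = (ziter X T n x\<^sub>0, y\<^sub>0)" for n
      using ziter_prod[OF dX dYid, of "(x\<^sub>0, y\<^sub>0)" n] ziter_unique[OF dYid, of "\<lambda>_. y\<^sub>0" n] xy by simp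
    then have orb: "zorbit X T x\<^sub>0 \<subseteq> {x \<in> mspace X. (x, y\<^sub>0) \<in> J}"
      using in_J J_sub by (auto simp: zorbit_def)
    have J_closed: "closedin (prod_topology (mtopology_of X) (mtopology_of Y)) J"
      using J(1) by (simp add: closed_invariant_def)
    have "closedin (mtopology_of X) {x \<in> topspace (mtopology_of X). (x, y\<^sub>0) \<in> J}"
      using xy by (intro closedin_continuous_map_preimage[OF _ J_closed] continuous_map_pairedI) auto
    then have "mtopology_of X closure_of zorbit X T x\<^sub>0 \<subseteq> {x \<in> mspace X. (x, y\<^sub>0) \<in> J}"
      using orb by (intro closure_of_minimal) auto
    then have y0: "(x, y\<^sub>0) \<in> J" if "x \<in> mspace X" for x
      using X xy that by (auto simp: minimal_system_def)
    \<comment> \<open>\<open>C\<close> collects the heights whose whole slice lies in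
      \<open>J\<close>. Since \<open>T\<close> permutes the carrier of \<open>X\<close>, it is
      invariant under \<open>S\<close>, and minimality of \<open>Y\<close> spreads it from
      \<open>y\<^sub>0\<close> to everything.\<close>
    define C where "C = (\<Inter>x\<in>mspace X. {y \<in> topspace (mtopology_of Y). (x, y) \<in> J})"
    have "closedin (mtopology_of Y) C"
      unfolding C_def
    proof (intro closedin_INT)
      show "closedin (mtopology_of Y) {y \<in> topspace (mtopology_of Y). (x, y) \<in> J}"
        if "x \<in> mspace X" for x
        using that by (intro closedin_continuous_map_preimage[OF _ J_closed] continuous_map_pairedI) auto
    qed (fact XY_ne)
    moreover have "S y \<in> C \<longleftrightarrow> y \<in> C" if y: "y \<in> mspace Y" for y
    proof -
      have "(T x, S y) \<in> J \<longleftrightarrow> (x, y) \<in> J" if "x \<in> mspace X" for x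
        using J(1) that y by (fastforce simp: closed_invariant_iff[OF dP])
      then have "(\<forall>x\<in>T ` mspace X. (x, S y) \<in> J) \<longleftrightarrow> (\<forall>x\<in>mspace X. (x, y) \<in> J)" by simp
      then show ?thesis
        using y dyn_system_in[OF dY y] XY_ne unfolding dyn_system_surj[OF dX] by (auto simp: C_def)
    qed
    ultimately have "closed_invariant Y S C" by (simp add: closed_invariant_iff[OF dY])
    moreover have "y\<^sub>0 \<in> C" using y0 xy by (simp add: C_def)
    ultimately have "C = mspace Y" using minimal_system_closed_invariant[OF Y] by blast
    then have "mspace X \<times> mspace Y \<subseteq> J" by (auto simp: C_def)
    then show "J = mspace ?P" using J_sub by simp
  qed
  ultimately show ?thesis by blast
qed

end
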